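(* Let $w \in S_n$. Then the poset $P_w = ([e,w], \leq_w)$ is a lattice.
   Context: $S_n$ is the symmetric group on $\{1,\ldots,n\}$ with simple reflections $s_i=(i\ i+1)$, Coxeter length $\ell$, and identity $e$. The (strong) Bruhat order $\preceq$ on $S_n$ has cover relations $x \prec xt$ whenever $t$ is a transposition with $\ell(xt)=\ell(x)+1$. Write $[e,w]=\{u\in S_n \mid u\preceq w\}$. For $u\in S_n$ let $\boldsymbol{u}=(u^{-1}(1),\ldots,u^{-1}(n))\in\mathbb{R}^n$. The Bruhat interval polytope of $w\in S_n$ is $Q_w=\mathrm{Conv}(\{\boldsymbol{u}\mid u\preceq w\})\subset\mathbb{R}^n$; its vertices are exactly the points $\boldsymbol{u}$ with $u\in[e,w]$. The 1-skeleton poset $(P_w,\leq_w)$ has underlying set $[e,w]$ and cover relations $u\lessdot_w v$ whenever $Q_w$ has an edge between the vertices $\boldsymbol{u}$ and $\boldsymbol{v}$ and $\ell(v)>\ell(u)$. *)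

theory Defs
  imports "HOL-Analysis.Analysis" "HOL-Algebra.Lattice" "HOL-Combinatorics.Permutations"
begin

text \<open>
  Elements of the symmetric group on \<open>{1, ..., n}\<close> are functions \<open>u :: nat \<Rightarrow> nat\<close> with
  \<open>u permutes {1..n}\<close>, and the product is composition: \<open>x t\<close> is \<open>x \<circ> t\<close>.
\<close>

definition simple_reflection :: "nat \<Rightarrow> nat \<Rightarrow> nat" where
  "simple_reflection i = Transposition.transpose i (i + 1)"

definition coxeter_length :: "nat \<Rightarrow> (nat \<Rightarrow> nat) \<Rightarrow> nat" where
  "coxeter_length n u =
     (LEAST k. \<exists>js. length js = k \<and> set js \<subseteq> {1..<n} \<and> u = foldr (\<circ>) (map simple_reflection js) id)"

definition bruhat_cover :: "nat \<Rightarrow> (nat \<Rightarrow> nat) \<Rightarrow> (nat \<Rightarrow> nat) \<Rightarrow> bool" where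
  "bruhat_cover n x y \<longleftrightarrow>
     x permutes {1..n} \<and>
     (\<exists>i\<in>{1..n}. \<exists>j\<in>{1..n}. i \<noteq> j \<and> y = x \<circ> Transposition.transpose i j) \<and>
     coxeter_length n y = coxeter_length n x + 1"

definition bruhat_le :: "nat \<Rightarrow> (nat \<Rightarrow> nat) \<Rightarrow> (nat \<Rightarrow> nat) \<Rightarrow> bool" where
  "bruhat_le n = (bruhat_cover n)\<^sup>*\<^sup>*"

definition lower_interval :: "nat \<Rightarrow> (nat \<Rightarrow> nat) \<Rightarrow> (nat \<Rightarrow> nat) set" where
  "lower_interval n w = {u. u permutes {1..n} \<and> bruhat_le n u w}"

text \<open>
  Points of n-dimensional space have type \<open>real ^ 'n\<close>. A bijection \<open>c :: 'n \<Rightarrow> nat\<close> from the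
  coordinate type onto \<open>{1..n}\<close> says which coordinate is the first, the second, and so on; it
  is a parameter because a finite type carries no canonical numbering.
\<close>

definition perm_point :: "('n::finite \<Rightarrow> nat) \<Rightarrow> (nat \<Rightarrow> nat) \<Rightarrow> real ^ 'n" where
  "perm_point c u = (\<chi> i. real (inv u (c i)))"

definition bruhat_interval_polytope ::
    "nat \<Rightarrow> ('n::finite \<Rightarrow> nat) \<Rightarrow> (nat \<Rightarrow> nat) \<Rightarrow> (real ^ 'n) set" where
  "bruhat_interval_polytope n c w = convex hull (perm_point c ` lower_interval n w)"

definition skeleton_cover ::
    "nat \<Rightarrow> ('n::finite \<Rightarrow> nat) \<Rightarrow> (nat \<Rightarrow> nat) \<Rightarrow> (nat \<Rightarrow> nat) \<Rightarrow> (nat \<Rightarrow> nat) \<Rightarrow> bool" where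
  "skeleton_cover n c w u v \<longleftrightarrow>
     u \<in> lower_interval n w \<and> v \<in> lower_interval n w \<and>
     closed_segment (perm_point c u) (perm_point c v) edge_of bruhat_interval_polytope n c w \<and>
     coxeter_length n v > coxeter_length n u"

text \<open>
  The order is the reflexive transitive closure of the relation given by the edges. That it is
  antisymmetric is part of the library predicate \<open>lattice\<close> on such records.
\<close>

definition skeleton_poset ::
    "nat \<Rightarrow> ('n::finite \<Rightarrow> nat) \<Rightarrow> (nat \<Rightarrow> nat) \<Rightarrow> (nat \<Rightarrow> nat) gorder" where
  "skeleton_poset n c w =
     \<lparr>carrier = lower_interval n w, eq = (=), le = (skeleton_cover n c w)\<^sup>*\<^sup>*\<rparr>"

end

theory Submission
  imports Defs
begin

text \<open>
  The permutations of \<open>{1..n}\<close> label the chambers of the braid arrangement, and each chamber has a vertex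
  of the polytope \<open>Q\<^sub>w\<close>: the one at which the linear functionals in the chamber are maximal. That this
  vertex depends on the chamber only is the maximality property of lower Bruhat intervals
  (\<open>below_has_greatest\<close>, \<open>below_has_least\<close>). Crossing the wall between two chambers that are neighbours in
  weak order, by exchanging the adjacent values \<open>a < b\<close>, either keeps the vertex or exchanges \<open>a\<close> and \<open>b\<close>
  in it, and the latter happens exactly when the result is still below \<open>w\<close> and goes up
  (\<open>vertex_adjacent_swap\<close>). The edges of \<open>Q\<^sub>w\<close> are precisely the walls at which the vertex changes
  (\<open>edge_iff_vertex_cover\<close>). Thus the edge order is the image of weak order under the vertex map.

  The image of a lattice under an order-preserving map need not be a lattice. Here it is, because the
  vertex map preserves joins. Its fibre over \<open>u\<close> has \<open>u\<close> as its least element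
  (\<open>inversions_vertex_subset\<close>). Moreover, if a weak cover keeps the vertex, then so do the covers on the
  opposite side of the square or hexagon that it spans with any other cover
  (\<open>fibre_cover_local_commutation\<close>): the exchange that failed gives an element outside of the interval below
  \<open>w\<close>, and the exchanges on the opposite side would lead to elements above it. By an argument as in Newman's lemma this local fact gives a greatest element in each fibre,
  and shows that these greatest elements increase with the vertex. So the vertex map and the map to the top of
  the fibre form a Galois connection (\<open>vertex_le_iff\<close>). The meet of a set of vertices is then the
  vertex of the weak-order meet of the tops of their fibres (\<open>vertex_meet_exists\<close>), and an order with all
  meets has all joins.
\<close>

section \<open>Inversions\<close>

abbreviation swap :: "nat \<Rightarrow> nat \<Rightarrow> nat \<Rightarrow> nat" where
  "swap a b \<equiv> Transposition.transpose a b"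

text \<open>
  A permutation \<open>u\<close> is handled through \<open>U = inv u\<close>, which sends a value to its position. This is the
  point of the polytope that belongs to \<open>u\<close>, and exchanging the values \<open>a\<close> and \<open>b\<close> in \<open>u\<close> becomes
  \<open>U \<circ> swap a b\<close>, whatever the positions are.
\<close>
definition inversions :: "nat \<Rightarrow> (nat \<Rightarrow> 'a::linorder) \<Rightarrow> (nat \<times> nat) set" where
  "inversions n U = {(a, b). a \<in> {1..n} \<and> b \<in> {1..n} \<and> a < b \<and> U b < U a}"

text \<open>
  One step of Bruhat order in which the values are compared by a ranking \<open>T\<close> in place of their
  natural order. For \<open>T = \<tau>\<^sup>-\<^sup>1\<close> this is Bruhat order translated by \<open>\<tau>\<close>: it relates \<open>u\<close> to \<open>v\<close> when
  \<open>\<tau>\<^sup>-\<^sup>1 u\<close> is below \<open>\<tau>\<^sup>-\<^sup>1 v\<close>.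
\<close>
definition up_step :: "nat \<Rightarrow> (nat \<Rightarrow> 'a::linorder) \<Rightarrow> (nat \<Rightarrow> nat) \<Rightarrow> (nat \<Rightarrow> nat) \<Rightarrow> bool" where
  "up_step n T U V \<longleftrightarrow> (\<exists>a\<in>{1..n}. \<exists>b\<in>{1..n}. T a < T b \<and> U a < U b \<and> V = U \<circ> swap a b)"

lemma swap_apply: "swap a b x = (if x = a then b else if x = b then a else x)"
  by (simp add: Transposition.transpose_def)

lemma permutes_swap_comp:
  assumes "U permutes {1..n}" "a \<in> {1..n}" "b \<in> {1..n}"
  shows "U \<circ> swap a b permutes {1..n}"
  using assms by (intro permutes_compose permutes_swap_id) auto

lemma finite_inversions: "finite (inversions n U)"
  by (rule finite_subset[of _ "{1..n} \<times> {1..n}"]) (auto simp: inversions_def)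

text \<open>
  Exchanging the entries at \<open>a\<close> and \<open>b\<close> moves inversions to inversions, and creates only
  \<open>(a, b)\<close>. The pairs \<open>(a, c)\<close> and \<open>(c, b)\<close> with \<open>c\<close> strictly between stay in place:
  \<open>U c\<close> is outside the interval from \<open>U a\<close> to \<open>U b\<close> and compares in the same way with both ends.
\<close>
lemma card_inversions_cover:
  fixes U :: "nat \<Rightarrow> 'a::linorder"
  assumes inj: "inj_on U {1..n}" and ab: "a \<in> {1..n}" "b \<in> {1..n}" "a < b" "U a < U b"
    and gap: "\<And>c. a < c \<Longrightarrow> c < b \<Longrightarrow> \<not> (U a < U c \<and> U c < U b)"
  shows "card (inversions n (U \<circ> swap a b)) = Suc (card (inversions n U))"
proof -
  \<comment> \<open>Conjugation by the transposition, except on the pairs that it would turn around.\<close>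
  define h where "h = (\<lambda>(p, q). if (p = a \<and> q < b) \<or> (q = b \<and> a < p) then (p, q)
                                else (swap a b p, swap a b q))"
  have gap': "U c < U a \<or> U b < U c" if "a < c" "c < b" for c
  proof -
    have "c \<in> {1..n}" using that ab by auto
    then have "U c \<noteq> U a" "U c \<noteq> U b" using inj that ab by (auto dest: inj_onD)
    then show ?thesis using gap[OF that] by auto
  qed
  have hh: "h (h (p, q)) = (p, q)" if "p < q" for p q
    using that ab by (simp add: h_def swap_apply)
  have lt: "p < q" if "(p, q) \<in> inversions n X" for p q and X :: "nat \<Rightarrow> 'a"
    using that by (simp add: inversions_def)
  have "bij_betw h (inversions n U) (inversions n (U \<circ> swap a b) - {(a, b)})"
  proof (rule bij_betw_byWitness[where f' = h])
    show "\<forall>x\<in>inversions n U. h (h x) = x"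
      using hh lt by auto
    show "\<forall>x\<in>inversions n (U \<circ> swap a b) - {(a, b)}. h (h x) = x"
      using hh lt by auto
    show "h ` inversions n U \<subseteq> inversions n (U \<circ> swap a b) - {(a, b)}"
      using ab gap' by (fastforce simp: h_def inversions_def swap_apply split: if_splits)
    show "h ` (inversions n (U \<circ> swap a b) - {(a, b)}) \<subseteq> inversions n U"
      using ab gap' by (fastforce simp: h_def inversions_def swap_apply split: if_splits)
  qed
  then have "card (inversions n U) = card (inversions n (U \<circ> swap a b) - {(a, b)})"
    by (rule bij_betw_same_card)
  moreover have "(a, b) \<in> inversions n (U \<circ> swap a b)"
    using ab by (auto simp: inversions_def swap_apply)
  ultimately show ?thesis
    by (metis card_Suc_Diff1 finite_inversions)
qed

lemma increasing_if_no_descent: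
  fixes U :: "nat \<Rightarrow> 'a::linorder"
  assumes inj: "inj_on U {1..n}" and asc: "\<And>k. k \<in> {1..<n} \<Longrightarrow> \<not> U (Suc k) < U k"
    and "a \<in> {1..n}" "b \<in> {1..n}" "a < b"
  shows "U a < U b"
  using assms(3-5)
proof (induction b)
  case (Suc b)
  have "U b \<noteq> U (Suc b)" using inj Suc.prems by (auto dest!: inj_onD)
  moreover have "\<not> U (Suc b) < U b" using Suc.prems by (intro asc) auto
  ultimately have "U b < U (Suc b)" by auto
  then show ?case using Suc by (cases "a = b") (auto intro: less_trans)
qed simp

lemma permutes_increasing_imp_id:
  assumes "U permutes {1..n::nat}" and inc: "\<And>a b. a \<in> {1..n} \<Longrightarrow> b \<in> {1..n} \<Longrightarrow> a < b \<Longrightarrow> U a < U b"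
  shows "U = id"
proof -
  have ge: "a \<le> U a" if "a \<in> {1..n}" for a
    using that
  proof (induction a)
    case (Suc a)
    then show ?case
      using inc[of a "Suc a"] permutes_in_image[OF assms(1), of "Suc a"] by (cases "a = 0") auto
  qed simp
  have "(\<Sum>a\<in>{1..n}. U a) = (\<Sum>a\<in>{1..n}. a)"
    using sum.permute[OF assms(1), of "\<lambda>x. x"] by (simp add: comp_def)
  then have "U a = a" if "a \<in> {1..n}" for a
    using ge that sum_strict_mono_ex1[of "{1..n}" "\<lambda>x. x" U] by (metis finite_atLeastAtMost le_neq_implies_less nat_less_le)
  then show ?thesis using assms(1) by (auto simp: fun_eq_iff permutes_def)
qed

lemma swap_comp_swap [simp]: "U \<circ> swap a b \<circ> swap a b = U"
  by (simp add: comp_assoc)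

section \<open>Length and Bruhat order through inversions\<close>

abbreviation bruhat_step :: "nat \<Rightarrow> (nat \<Rightarrow> nat) \<Rightarrow> (nat \<Rightarrow> nat) \<Rightarrow> bool" where
  "bruhat_step n \<equiv> up_step n (\<lambda>a. a)"

definition cover_step :: "nat \<Rightarrow> (nat \<Rightarrow> nat) \<Rightarrow> (nat \<Rightarrow> nat) \<Rightarrow> bool" where
  "cover_step n U V \<longleftrightarrow> (\<exists>a\<in>{1..n}. \<exists>b\<in>{1..n}. a < b \<and> U a < U b \<and>
     (\<forall>c. a < c \<and> c < b \<longrightarrow> \<not> (U a < U c \<and> U c < U b)) \<and> V = U \<circ> swap a b)"

text \<open>
  If some \<open>c\<close> lies between in both senses, the values \<open>a < c < b\<close> stand in the order \<open>a c b\<close>, and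
  \<open>b c a\<close> is reached through \<open>c a b\<close> and \<open>b a c\<close> of the same three positions, by exchanges with
  fewer such \<open>c\<close>. Hence lengths strictly increase along all Bruhat steps, and the definition by
  covers gives the same order.
\<close>
lemma cover_steps_swap:
  assumes "a \<in> {1..n}" "b \<in> {1..n}" "a < b" "U a < U b"
  shows "(cover_step n)\<^sup>*\<^sup>* U (U \<circ> swap a b)"
  using assms
proof (induction "card {c. a < c \<and> c < b \<and> U a < U c \<and> U c < U b}" arbitrary: U a b
    rule: less_induct)
  case less
  let ?G = "\<lambda>U a b. {c. a < c \<and> c < b \<and> U a < U c \<and> U c < U b}"
  have fin: "finite (?G U a b)" by (rule finite_subset[of _ "{..<b}"]) auto
  show ?case
  proof (cases "?G U a b = {}")
    case True
    then have "cover_step n U (U \<circ> swap a b)"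
      using less.prems unfolding cover_step_def by blast
    then show ?thesis by blast
  next
    case False
    then obtain c where c: "a < c" "c < b" "U a < U c" "U c < U b" by blast
    define U1 where "U1 = U \<circ> swap a c"
    define U2 where "U2 = U1 \<circ> swap a b"
    have cn: "c \<in> {1..n}" using c less.prems by auto
    have "?G U a c \<subset> ?G U a b" using c by (intro psubsetI) auto
    then have "(cover_step n)\<^sup>*\<^sup>* U U1"
      unfolding U1_def using c cn less.prems by (intro less.hyps psubset_card_mono[OF fin]) auto
    moreover have "?G U1 a b \<subset> ?G U a b"
      using c by (intro psubsetI) (auto simp: U1_def swap_apply split: if_splits)
    then have "(cover_step n)\<^sup>*\<^sup>* U1 U2"
      unfolding U2_def using c cn less.prems
      by (intro less.hyps psubset_card_mono[OF fin]) (auto simp: U1_def swap_apply)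
    moreover have "?G U2 c b \<subset> ?G U a b"
      using c by (intro psubsetI) (auto simp: U2_def U1_def swap_apply split: if_splits)
    then have "(cover_step n)\<^sup>*\<^sup>* U2 (U2 \<circ> swap c b)"
      using c cn less.prems
      by (intro less.hyps psubset_card_mono[OF fin]) (auto simp: U2_def U1_def swap_apply)
    moreover have "U2 \<circ> swap c b = U \<circ> swap a b"
      using c by (auto simp: U2_def U1_def fun_eq_iff swap_apply)
    ultimately show ?thesis by (metis rtranclp_trans)
  qed
qed

lemma cover_step_card:
  assumes "cover_step n U V" "U permutes {1..n}"
  shows "V permutes {1..n} \<and> card (inversions n V) = Suc (card (inversions n U))"
  using assms card_inversions_cover[OF permutes_inj_on[OF assms(2)]] permutes_swap_comp[OF assms(2)]
  unfolding cover_step_def by blast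

lemma cover_imp_up_step: "cover_step n U V \<Longrightarrow> bruhat_step n U V"
  unfolding cover_step_def up_step_def by auto

lemma up_step_imp_cover_steps: "bruhat_step n U V \<Longrightarrow> (cover_step n)\<^sup>*\<^sup>* U V"
  unfolding up_step_def using cover_steps_swap by fastforce

lemma up_steps_eq_cover_steps: "(bruhat_step n)\<^sup>*\<^sup>* = (cover_step n)\<^sup>*\<^sup>*"
proof (intro ext iffI)
  fix U V
  assume "(bruhat_step n)\<^sup>*\<^sup>* U V"
  then show "(cover_step n)\<^sup>*\<^sup>* U V"
    by induction (auto dest: up_step_imp_cover_steps)
next
  fix U V
  assume "(cover_step n)\<^sup>*\<^sup>* U V"
  then show "(bruhat_step n)\<^sup>*\<^sup>* U V"
    by (rule rtranclp_mono[THEN predicate2D, rotated]) (auto intro: cover_imp_up_step)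
qed

lemma up_step_card_less:
  assumes "bruhat_step n U V" "U permutes {1..n}"
  shows "card (inversions n U) < card (inversions n V)"
proof -
  have "U = X \<or> card (inversions n U) < card (inversions n X)" and "X permutes {1..n}"
    if "(cover_step n)\<^sup>*\<^sup>* U X" for X
    using that assms(2) by (induction) (auto dest: cover_step_card)
  moreover have "U \<noteq> V"
    using assms(1) unfolding up_step_def by (metis comp_apply less_irrefl swap_apply)
  ultimately show ?thesis
    using up_step_imp_cover_steps[OF assms(1)] by auto
qed

lemma card_inversions_descent:
  fixes U :: "nat \<Rightarrow> 'a::linorder"
  assumes inj: "inj_on U {1..n}" and k: "k \<in> {1..<n}" "U (Suc k) < U k"
  shows "card (inversions n U) = Suc (card (inversions n (U \<circ> swap k (Suc k))))"
proof -
  let ?s = "swap k (Suc k)"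
  have "?s permutes {1..n}" using k by (intro permutes_swap_id) auto
  then have "inj_on (U \<circ> ?s) {1..n}"
    using inj by (metis comp_inj_on permutes_image permutes_inj_on)
  from card_inversions_cover[OF this, of k "Suc k"] show ?thesis
    using k by (simp add: swap_apply) 
qed

abbreviation word_prod :: "nat list \<Rightarrow> nat \<Rightarrow> nat" where
  "word_prod js \<equiv> foldr (\<circ>) (map simple_reflection js) id"

lemma inv_swap_comp:
  assumes "u permutes {1..n::nat}" "a \<in> {1..n}" "b \<in> {1..n}"
  shows "inv (swap a b \<circ> u) = inv u \<circ> swap a b"
  by (subst o_inv_distrib) (use assms permutes_bij in auto)

lemma word_prod_length:
  assumes "set js \<subseteq> {1..<n}"
  shows "word_prod js permutes {1..n} \<and> card (inversions n (inv (word_prod js))) \<le> length js"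
  using assms
proof (induction js)
  case Nil
  have "inversions n (inv id) = {}" unfolding inv_id by (auto simp: inversions_def)
  then have "card (inversions n (inv id)) = 0" by (simp only: card.empty)
  moreover have wp: "word_prod [] = id" by simp
  ultimately show ?case
    unfolding wp using permutes_id[of "{1..n}"] by (intro conjI) (assumption, linarith)
next
  case (Cons k js)
  define u where "u = word_prod js"
  define U where "U = inv u"
  have js: "set js \<subseteq> {1..<n}" and k: "k \<in> {1..n}" "Suc k \<in> {1..n}" "k \<in> {1..<n}"
    using Cons.prems by auto
  have u: "u permutes {1..n}" and len: "card (inversions n U) \<le> length js"
    using Cons.IH[OF js] by (simp_all only: u_def U_def)
  have U: "U permutes {1..n}" unfolding U_def by (rule permutes_inv[OF u])
  have "card (inversions n (U \<circ> swap k (Suc k))) \<le> Suc (card (inversions n U))"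
  proof (cases "U k < U (Suc k)")
    case True
    then show ?thesis
      using card_inversions_cover[OF permutes_inj_on[OF U] k(1,2)] by fastforce
  next
    case False
    moreover have "U k \<noteq> U (Suc k)" using U by (metis n_not_Suc_n permutes_def)
    ultimately show ?thesis
      using card_inversions_descent[OF permutes_inj_on[OF U] k(3)] by auto
  qed
  moreover have prod: "word_prod (k # js) = swap k (Suc k) \<circ> u"
    unfolding u_def by (simp add: simple_reflection_def)
  moreover have "inv (swap k (Suc k) \<circ> u) = U \<circ> swap k (Suc k)"
    unfolding U_def by (rule inv_swap_comp[OF u k(1,2)])
  moreover have "swap k (Suc k) \<circ> u permutes {1..n}"
    by (intro permutes_compose[OF u] permutes_swap_id k)
  ultimately show ?case using len unfolding prod by (metis Suc_le_mono le_trans length_Cons)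
qed

lemma word_exists:
  assumes "u permutes {1..n}"
  shows "\<exists>js. length js = card (inversions n (inv u)) \<and> set js \<subseteq> {1..<n} \<and> u = word_prod js"
  using assms
proof (induction "card (inversions n (inv u))" arbitrary: u rule: less_induct)
  case less
  have U: "inv u permutes {1..n}" using less.prems by (intro permutes_inv)
  show ?case
  proof (cases "\<exists>k\<in>{1..<n}. inv u (Suc k) < inv u k")
    case True
    then obtain k where k: "k \<in> {1..<n}" "inv u (Suc k) < inv u k" by blast
    define v where "v = swap k (Suc k) \<circ> u"
    have v: "v permutes {1..n}"
      unfolding v_def using less.prems k by (intro permutes_compose permutes_swap_id) auto
    have inv_v: "inv v = inv u \<circ> swap k (Suc k)"
      unfolding v_def using less.prems k by (intro inv_swap_comp) auto
    have card: "card (inversions n (inv u)) = Suc (card (inversions n (inv v)))"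
      unfolding inv_v by (rule card_inversions_descent[OF permutes_inj_on[OF U] k])
    then obtain js where "length js = card (inversions n (inv v))" "set js \<subseteq> {1..<n}"
      "v = word_prod js"
      using less.hyps[OF _ v] by auto
    moreover have "u = swap k (Suc k) \<circ> v" by (simp add: v_def comp_assoc[symmetric])
    ultimately show ?thesis
      using k card by (intro exI[of _ "k # js"]) (auto simp: simple_reflection_def)
  next
    case False
    then have "inv u = id"
      using increasing_if_no_descent[OF permutes_inj_on[OF U]] permutes_increasing_imp_id[OF U]
      by blast
    then have "u = id" using less.prems by (metis inv_id permutes_inv_inv)
    moreover have "inversions n (inv id) = {}" unfolding inv_id by (auto simp: inversions_def)
    moreover have "word_prod [] = id" by simp
    ultimately show ?thesis by (metis card.empty empty_subsetI list.size(3) set_empty2)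
  qed
qed

lemma coxeter_length_eq:
  assumes "u permutes {1..n}"
  shows "coxeter_length n u = card (inversions n (inv u))"
  unfolding coxeter_length_def
proof (rule Least_equality)
  show "\<exists>js. length js = card (inversions n (inv u)) \<and> set js \<subseteq> {1..<n} \<and> u = word_prod js"
    by (rule word_exists[OF assms])
next
  fix k
  assume "\<exists>js. length js = k \<and> set js \<subseteq> {1..<n} \<and> u = word_prod js"
  then show "card (inversions n (inv u)) \<le> k" using word_prod_length by blast
qed

lemma inv_comp_swap:
  assumes "x permutes {1..n::nat}" "i \<in> {1..n}" "j \<in> {1..n}"
  shows "inv (x \<circ> swap i j) = inv x \<circ> swap (x i) (x j)"
proof -
  have "x \<circ> swap i j = swap (x i) (x j) \<circ> x"
    using permutes_inj[OF assms(1)] by (auto simp: fun_eq_iff swap_apply dest: injD)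
  moreover have "x i \<in> {1..n}" "x j \<in> {1..n}" using assms permutes_in_image by metis+
  ultimately show ?thesis using inv_swap_comp[OF assms(1)] by metis
qed

text \<open>
  A transposition that went down would lower the number of inversions.
\<close>
lemma bruhat_cover_imp_up_step:
  assumes "bruhat_cover n x y"
  shows "bruhat_step n (inv x) (inv y) \<and> y permutes {1..n}"
proof -
  obtain i j where x: "x permutes {1..n}" and ij: "i \<in> {1..n}" "j \<in> {1..n}" "i \<noteq> j"
    and y: "y = x \<circ> swap i j" and len: "coxeter_length n y = coxeter_length n x + 1"
    using assms unfolding bruhat_cover_def by blast
  have y': "y permutes {1..n}" unfolding y using x ij by (intro permutes_swap_comp)
  define X where "X = inv x"
  define a where "a = min (x i) (x j)"
  define b where "b = max (x i) (x j)"
  have ne: "x i \<noteq> x j" using ij x by (metis permutes_def)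
  have xin: "x i \<in> {1..n}" "x j \<in> {1..n}" using ij x permutes_in_image by metis+
  have ab: "a \<in> {1..n}" "b \<in> {1..n}" "a < b"
    using ne xin unfolding a_def b_def by (auto simp: min_def max_def)
  have X: "X permutes {1..n}" unfolding X_def using x by (rule permutes_inv)
  have Y: "inv y = X \<circ> swap a b"
    unfolding y X_def inv_comp_swap[OF x ij(1,2)] a_def b_def
    by (auto simp: min_def max_def Transposition.transpose_commute)
  have len': "card (inversions n (inv y)) = Suc (card (inversions n X))"
    using len x y' by (simp add: coxeter_length_eq X_def)
  have "X a \<noteq> X b" using ab X by (metis less_irrefl permutes_def)
  moreover have "\<not> X b < X a"
  proof
    assume "X b < X a"
    then have "bruhat_step n (inv y) X"
      unfolding up_step_def Y using ab
      by (intro bexI[of _ a] bexI[of _ b]) (auto simp: swap_apply)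
    from up_step_card_less[OF this] show False
      using len' y' by (simp add: permutes_inv)
  qed
  ultimately have "bruhat_step n X (inv y)"
    unfolding up_step_def using ab Y by (intro bexI[of _ a] bexI[of _ b]) auto
  then show ?thesis using y' by (simp add: X_def)
qed

lemma cover_step_imp_bruhat_cover:
  assumes "cover_step n (inv x) (inv y)" "x permutes {1..n}" "y permutes {1..n}"
  shows "bruhat_cover n x y"
proof -
  have X: "inv x permutes {1..n}" using assms by (intro permutes_inv)
  obtain a b where ab: "a \<in> {1..n}" "b \<in> {1..n}" "a < b" "inv y = inv x \<circ> swap a b"
    using assms(1) unfolding cover_step_def by blast
  have "y = inv (inv x \<circ> swap a b)" using ab assms(3) by (metis permutes_inv_inv)
  then have "y = x \<circ> swap (inv x a) (inv x b)"
    using inv_comp_swap[OF X ab(1,2)] assms(2) by (simp add: permutes_inv_inv)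
  moreover have "inv x a \<noteq> inv x b" using ab X by (metis less_irrefl permutes_def)
  moreover have "inv x a \<in> {1..n}" "inv x b \<in> {1..n}" using ab X permutes_in_image by metis+
  moreover have "coxeter_length n y = coxeter_length n x + 1"
    using cover_step_card[OF assms(1) X] assms by (simp add: coxeter_length_eq)
  ultimately show ?thesis using assms(2) unfolding bruhat_cover_def by blast
qed

lemma bruhat_le_iff_up_steps:
  assumes "x permutes {1..n}" "y permutes {1..n}"
  shows "bruhat_le n x y \<longleftrightarrow> (bruhat_step n)\<^sup>*\<^sup>* (inv x) (inv y)"
proof
  assume "bruhat_le n x y"
  then have "(bruhat_cover n)\<^sup>*\<^sup>* x y" by (simp add: bruhat_le_def)
  then show "(bruhat_step n)\<^sup>*\<^sup>* (inv x) (inv y)"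
  proof (induction)
    case (step y z)
    then show ?case using bruhat_cover_imp_up_step by (meson rtranclp.rtrancl_into_rtrancl)
  qed simp
next
  have "(bruhat_cover n)\<^sup>*\<^sup>* x (inv V) \<and> V permutes {1..n}"
    if "(cover_step n)\<^sup>*\<^sup>* (inv x) V" for V
    using that
  proof (induction)
    case base
    then show ?case using assms by (simp add: permutes_inv permutes_inv_inv)
  next
    case (step V W)
    then have "W permutes {1..n}" using cover_step_card by blast
    then have "bruhat_cover n (inv V) (inv W)"
      using step by (intro cover_step_imp_bruhat_cover) (auto simp: permutes_inv_inv permutes_inv)
    then show ?case using step \<open>W permutes {1..n}\<close> by auto
  qed
  moreover assume "(bruhat_step n)\<^sup>*\<^sup>* (inv x) (inv y)"
  ultimately show "bruhat_le n x y"
    using assms by (metis bruhat_le_def permutes_inv_inv up_steps_eq_cover_steps)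
qed

section \<open>Translated Bruhat orders and the maximality property\<close>

definition below :: "nat \<Rightarrow> (nat \<Rightarrow> nat) \<Rightarrow> (nat \<Rightarrow> nat) set" where
  "below n W = {U. U permutes {1..n} \<and> (bruhat_step n)\<^sup>*\<^sup>* U W}"

lemma up_step_comp:
  assumes "up_step n T U V" and s: "s permutes {1..n}"
  shows "up_step n (T \<circ> s) (U \<circ> s) (V \<circ> s)"
proof -
  obtain a b where ab: "a \<in> {1..n}" "b \<in> {1..n}" "T a < T b" "U a < U b" "V = U \<circ> swap a b"
    using assms(1) unfolding up_step_def by blast
  have "inv s a \<in> {1..n}" "inv s b \<in> {1..n}"
    using ab permutes_in_image[OF permutes_inv[OF s]] by metis+
  moreover have "s (inv s a) = a" "s (inv s b) = b" using s by (simp_all add: permutes_inverses)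
  moreover have "V \<circ> s = U \<circ> s \<circ> swap (inv s a) (inv s b)"
    using ab(5) s by (auto simp: fun_eq_iff swap_apply permutes_inverses permutes_inv_eq)
  ultimately show ?thesis
    unfolding up_step_def using ab(3,4) by (metis comp_apply)
qed

lemma up_steps_comp:
  assumes "(up_step n T)\<^sup>*\<^sup>* U V" and s: "s permutes {1..n}"
  shows "(up_step n (T \<circ> s))\<^sup>*\<^sup>* (U \<circ> s) (V \<circ> s)"
  using assms(1)
proof (induction)
  case (step V W)
  have "up_step n (T \<circ> s) (V \<circ> s) (W \<circ> s)" by (rule up_step_comp[OF step.hyps(2) s])
  then show ?case by (rule rtranclp.rtrancl_into_rtrancl[OF step.IH])
qed simp

text \<open>
  The value of the linear functional with coefficients \<open>f\<close> at the vertex \<open>U\<close>. It decreases along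
  steps ranked by \<open>T\<close> if \<open>f\<close> increases with \<open>T\<close>; therefore the least element of a set for the ranking
  \<open>T\<close> maximises all functionals in the closed chamber of \<open>T\<close>.
\<close>
definition pairing :: "nat \<Rightarrow> (nat \<Rightarrow> real) \<Rightarrow> (nat \<Rightarrow> nat) \<Rightarrow> real" where
  "pairing n f U = (\<Sum>a\<in>{1..n}. f a * real (U a))"

lemma pairing_swap:
  assumes "a \<in> {1..n}" "b \<in> {1..n}" "a \<noteq> b"
  shows "pairing n f (U \<circ> swap a b) = pairing n f U - (f b - f a) * (real (U b) - real (U a))"
proof -
  have split: "(\<Sum>x\<in>{1..n}. g x) = g a + g b + (\<Sum>x\<in>{1..n} - {a} - {b}. g x)" for g :: "nat \<Rightarrow> real"
    using assms sum.remove[of "{1..n}" a g] sum.remove[of "{1..n} - {a}" b g]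
    by (simp add: add.assoc)
  have "(\<Sum>x\<in>{1..n} - {a} - {b}. f x * real ((U \<circ> swap a b) x)) =
        (\<Sum>x\<in>{1..n} - {a} - {b}. f x * real (U x))"
    by (intro sum.cong) (auto simp: swap_apply)
  then show ?thesis
    unfolding pairing_def by (subst (1 2) split) (simp add: swap_apply algebra_simps)
qed

lemma pairing_up_step:
  assumes "up_step n T U V"
    and f: "\<And>a b. a \<in> {1..n} \<Longrightarrow> b \<in> {1..n} \<Longrightarrow> T a < T b \<Longrightarrow> f a \<le> f b"
  shows "pairing n f V \<le> pairing n f U"
proof -
  obtain a b where ab: "a \<in> {1..n}" "b \<in> {1..n}" "T a < T b" "U a < U b" "V = U \<circ> swap a b"
    using assms(1) unfolding up_step_def by blast
  have "a \<noteq> b" using ab by auto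
  moreover have "(f b - f a) * (real (U b) - real (U a)) \<ge> 0"
    using f[OF ab(1-3)] ab(4) by simp
  ultimately show ?thesis using ab by (simp add: pairing_swap)
qed

lemma pairing_up_steps:
  assumes "(up_step n T)\<^sup>*\<^sup>* U V"
    and f: "\<And>a b. a \<in> {1..n} \<Longrightarrow> b \<in> {1..n} \<Longrightarrow> T a < T b \<Longrightarrow> f a \<le> f b"
  shows "pairing n f V \<le> pairing n f U"
  using assms(1)
proof (induction)
  case (step V X)
  show ?case by (rule order_trans[OF pairing_up_step[OF step.hyps(2) f] step.IH])
qed simp

text \<open>
  Each step lowers the pairing by \<open>(f b - f a) * (U b - U a)\<close>. So if the two ends have the same pairing,
  every step exchanges values on which \<open>f\<close> agrees.
\<close>
lemma up_steps_within_level_sets: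
  assumes "(up_step n T)\<^sup>*\<^sup>* U V"
    and f: "\<And>a b. a \<in> {1..n} \<Longrightarrow> b \<in> {1..n} \<Longrightarrow> T a < T b \<Longrightarrow> f a \<le> f b"
    and eq: "pairing n f U \<le> pairing n f V"
    and R: "\<And>X a b. a \<in> {1..n} \<Longrightarrow> b \<in> {1..n} \<Longrightarrow> T a < T b \<Longrightarrow> f a = f b \<Longrightarrow> X a < X b \<Longrightarrow>
              R X (X \<circ> swap a b)"
  shows "R\<^sup>*\<^sup>* U V"
  using assms(1) eq
proof (induction)
  case (step V Y)
  obtain a b where ab: "a \<in> {1..n}" "b \<in> {1..n}" "T a < T b" "V a < V b" "Y = V \<circ> swap a b"
    using step.hyps(2) unfolding up_step_def by blast
  have le: "pairing n f Y \<le> pairing n f V" "pairing n f V \<le> pairing n f U"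
    using pairing_up_step[OF step.hyps(2) f] pairing_up_steps[OF step.hyps(1) f] by auto
  then have "pairing n f Y = pairing n f V" using step.prems by linarith
  then have "(f b - f a) * (real (V b) - real (V a)) = 0"
    using ab pairing_swap[of a n b f V] by fastforce
  then have "f a = f b" using ab by auto
  then have "R V Y" using R ab by blast
  moreover have "pairing n f U \<le> pairing n f V" using le step.prems by linarith
  ultimately show ?case using step.IH by (meson rtranclp.rtrancl_into_rtrancl)
qed simp

lemma up_steps_antisym:
  fixes T :: "nat \<Rightarrow> 'a::linorder"
  assumes "(up_step n T)\<^sup>*\<^sup>* U V" "(up_step n T)\<^sup>*\<^sup>* V U"
  shows "U = V"
proof -
  \<comment> \<open>A real-valued form of \<open>T\<close>, under which no proper step preserves the pairing.\<close>
  define f where "f a = real (card {c \<in> {1..n}. T c < T a})" for a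
  have f: "f a < f b" if "a \<in> {1..n}" "b \<in> {1..n}" "T a < T b" for a b
    unfolding f_def of_nat_less_iff using that by (intro psubset_card_mono) auto
  note f' = less_imp_le[OF f]
  have "(=)\<^sup>*\<^sup>* U V"
  proof (rule up_steps_within_level_sets[OF assms(1) f' pairing_up_steps[OF assms(2) f']])
    fix X :: "nat \<Rightarrow> nat" and a b
    assume "a \<in> {1..n}" "b \<in> {1..n}" "T a < T b" "f a = f b"
    then show "X = X \<circ> swap a b" using f by fastforce
  qed
  then show ?thesis by (induction) auto
qed

text \<open>
  \<open>swap k (Suc k)\<close> keeps the order of every pair of values except \<open>k, Suc k\<close> itself. The next two
  lemmas, which together are the lifting property of Bruhat order, follow by taking the first or the
  last exceptional step of a chain.
\<close>
lemma bruhat_step_lift: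
  assumes "bruhat_step n X Y" "k \<in> {1..<n}"
  shows "bruhat_step n (X \<circ> swap k (Suc k)) (Y \<circ> swap k (Suc k)) \<or> Y = X \<circ> swap k (Suc k)"
proof -
  let ?s = "swap k (Suc k)"
  obtain a b where ab: "a \<in> {1..n}" "b \<in> {1..n}" "a < b" "X a < X b" "Y = X \<circ> swap a b"
    using assms(1) unfolding up_step_def by blast
  show ?thesis
  proof (cases "a = k \<and> b = Suc k")
    case False
    then have "?s a < ?s b" using ab(3) by (auto simp: swap_apply)
    moreover have "?s a \<in> {1..n}" "?s b \<in> {1..n}" using ab assms(2) by (auto simp: swap_apply)
    moreover have "Y \<circ> ?s = X \<circ> ?s \<circ> swap (?s a) (?s b)"
      using ab(5) by (auto simp: fun_eq_iff swap_apply)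
    moreover have "(X \<circ> ?s) (?s a) < (X \<circ> ?s) (?s b)" using ab(4) by simp
    ultimately show ?thesis unfolding up_step_def by blast
  qed (use ab in simp)
qed

lemma bruhat_lift_left:
  assumes "(bruhat_step n)\<^sup>*\<^sup>* X Y" "k \<in> {1..<n}"
  shows "(bruhat_step n)\<^sup>*\<^sup>* (X \<circ> swap k (Suc k)) (Y \<circ> swap k (Suc k)) \<or>
         (bruhat_step n)\<^sup>*\<^sup>* (X \<circ> swap k (Suc k)) Y"
  using assms(1)
proof (induction rule: converse_rtranclp_induct)
  case (step X Z)
  then show ?case
    using bruhat_step_lift[OF step.hyps(1) assms(2)] by (metis converse_rtranclp_into_rtranclp)
qed simp

lemma bruhat_lift_right:
  assumes "(bruhat_step n)\<^sup>*\<^sup>* X Y" "k \<in> {1..<n}"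
  shows "(bruhat_step n)\<^sup>*\<^sup>* (X \<circ> swap k (Suc k)) (Y \<circ> swap k (Suc k)) \<or>
         (bruhat_step n)\<^sup>*\<^sup>* X (Y \<circ> swap k (Suc k))"
  using assms(1)
proof (induction)
  case (step Y Z)
  then show ?case
    using bruhat_step_lift[OF step.hyps(2) assms(2)]
    by (metis rtranclp.rtrancl_into_rtrancl swap_comp_swap)
qed simp

lemma up_step_swap:
  assumes "T a < T b" "U a < U b" "a \<in> {1..n}" "b \<in> {1..n}"
  shows "up_step n T U (U \<circ> swap a b)"
  unfolding up_step_def using assms by blast

text \<open>
  The maximality property of Gelfand and Serganova: a lower Bruhat interval has a greatest element
  in each translated Bruhat order. The induction removes one descent \<open>k\<close> of the ranking \<open>T\<close>.
  If \<open>W\<close> has a descent at \<open>k\<close>, the interval is invariant under \<open>s = swap k (Suc k)\<close>. Otherwise the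
  induction hypothesis for the interval below \<open>W \<circ> s\<close>, which is the union of the old interval and its
  image under \<open>s\<close>, gives a greatest element, and one has to see that it lies in that image.
\<close>
lemma below_has_greatest:
  fixes T :: "nat \<Rightarrow> 'a::linorder"
  assumes "inj_on T {1..n}" "W permutes {1..n}"
  shows "\<exists>U\<in>below n W. \<forall>Y\<in>below n W. (up_step n T)\<^sup>*\<^sup>* Y U"
  using assms
proof (induction "card (inversions n T)" arbitrary: T W rule: less_induct)
  case less
  show ?case
  proof (cases "\<exists>k\<in>{1..<n}. T (Suc k) < T k")
    case False
    then have mono: "T a < T b \<longleftrightarrow> a < b" if "a \<in> {1..n}" "b \<in> {1..n}" for a b
      using increasing_if_no_descent[OF less.prems(1)] that
      by (metis less_asym less_irrefl linorder_neqE_nat)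
    then have "up_step n T = bruhat_step n"
      unfolding up_step_def by (intro ext) auto
    then show ?thesis using less.prems(2) by (intro bexI[of _ W]) (auto simp: below_def)
  next
    case True
    then obtain k where k: "k \<in> {1..<n}" "T (Suc k) < T k" by blast
    then have kn: "k \<in> {1..n}" "Suc k \<in> {1..n}" by auto
    let ?s = "swap k (Suc k)"
    define S where "S = T \<circ> ?s"
    have s: "?s permutes {1..n}" using kn by (intro permutes_swap_id)
    have TS: "T = S \<circ> ?s" by (simp add: S_def)
    have "inj_on S {1..n}"
      unfolding S_def using less.prems(1) s by (metis comp_inj_on permutes_image permutes_inj_on)
    moreover have "card (inversions n S) < card (inversions n T)"
      unfolding S_def using card_inversions_descent[OF less.prems(1) k] by simp
    ultimately have IH: "\<exists>U\<in>below n V. \<forall>Y\<in>below n V. (up_step n S)\<^sup>*\<^sup>* Y U"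
      if "V permutes {1..n}" for V
      using less.hyps that by blast
    have perm_s: "X \<circ> ?s permutes {1..n}" if "X permutes {1..n}" for X
      using that kn by (intro permutes_swap_comp)
    have transfer: "(up_step n T)\<^sup>*\<^sup>* Y (U \<circ> ?s)" if "(up_step n S)\<^sup>*\<^sup>* (Y \<circ> ?s) U" for Y U
      using up_steps_comp[OF that s] unfolding TS by simp
    consider "W (Suc k) < W k" | "W k < W (Suc k)"
      using less.prems(2) by (metis linorder_neqE_nat n_not_Suc_n permutes_def)
    then show ?thesis
    proof cases
      case 1
      then have "bruhat_step n (W \<circ> ?s) W"
        using up_step_swap[of "\<lambda>a. a" k "Suc k" "W \<circ> ?s" n] kn by (simp add: swap_apply)
      then have stable: "X \<circ> ?s \<in> below n W" if "X \<in> below n W" for X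
        using that bruhat_lift_left[of n X W, OF _ k(1)] perm_s unfolding below_def
        by (blast intro: rtranclp.rtrancl_into_rtrancl)
      obtain U where "U \<in> below n W" "\<forall>Y\<in>below n W. (up_step n S)\<^sup>*\<^sup>* Y U"
        using IH[OF less.prems(2)] by blast
      then show ?thesis using stable transfer by (intro bexI[of _ "U \<circ> ?s"]) auto
    next
      case 2
      let ?V = "W \<circ> ?s"
      have WV: "bruhat_step n W ?V"
        using up_step_swap[of "\<lambda>a. a" k "Suc k" W n] kn 2 by simp
      obtain U where U: "U \<in> below n ?V" and max: "\<forall>Y\<in>below n ?V. (up_step n S)\<^sup>*\<^sup>* Y U"
        using IH[OF perm_s[OF less.prems(2)]] by blast
      have into: "Y \<circ> ?s \<in> below n ?V" if "Y \<in> below n W" for Y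
        using that bruhat_lift_left[of n Y W, OF _ k(1)] perm_s WV unfolding below_def
        by (blast intro: rtranclp.rtrancl_into_rtrancl)
      \<comment> \<open>Otherwise \<open>U\<close> is below \<open>W\<close> and has no descent at \<open>k\<close>; then \<open>U \<circ> s\<close> exceeds \<open>U\<close> in the ranking \<open>S\<close>.\<close>
      have "U \<circ> ?s \<in> below n W"
      proof (rule ccontr)
        assume not: "U \<circ> ?s \<notin> below n W"
        have U': "U permutes {1..n}" using U by (simp add: below_def)
        have "(bruhat_step n)\<^sup>*\<^sup>* (U \<circ> ?s) W \<or> (bruhat_step n)\<^sup>*\<^sup>* U W"
          using bruhat_lift_right[of n U ?V, OF _ k(1)] U by (simp add: below_def)
        then have UW: "U \<in> below n W" using not U' perm_s by (auto simp: below_def)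
        have "\<not> U (Suc k) < U k"
        proof
          assume "U (Suc k) < U k"
          then have "bruhat_step n (U \<circ> ?s) U"
            using up_step_swap[of "\<lambda>a. a" k "Suc k" "U \<circ> ?s" n] kn by (simp add: swap_apply)
          then show False
            using UW not perm_s[OF U'] unfolding below_def
            by (blast intro: converse_rtranclp_into_rtranclp)
        qed
        moreover have "U k \<noteq> U (Suc k)" using U' by (metis n_not_Suc_n permutes_def)
        ultimately have less: "U k < U (Suc k)" by auto
        moreover have "S k < S (Suc k)" using k by (simp add: S_def swap_apply)
        ultimately have "(up_step n S)\<^sup>*\<^sup>* U (U \<circ> ?s)"
          using kn by (intro r_into_rtranclp up_step_swap)
        moreover have "(up_step n S)\<^sup>*\<^sup>* (U \<circ> ?s) U" using max into[OF UW] by blast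
        ultimately have "U = U \<circ> ?s" by (rule up_steps_antisym)
        then have "U k = U (Suc k)" by (metis comp_apply swap_apply)
        then show False using less by simp
      qed
      then show ?thesis using into max transfer by (intro bexI[of _ "U \<circ> ?s"]) auto
    qed
  qed
qed

text \<open>
  Reversing the ranking reverses each step.
\<close>
lemma below_has_least:
  assumes "T permutes {1..n}" "W permutes {1..n}"
  shows "\<exists>U\<in>below n W. \<forall>Y\<in>below n W. (up_step n T)\<^sup>*\<^sup>* U Y"
proof -
  have rev: "up_step n T V U" if "up_step n (\<lambda>a. - int (T a)) U V" for U V
  proof -
    obtain a b where ab: "a \<in> {1..n}" "b \<in> {1..n}" "T b < T a" "U a < U b" "V = U \<circ> swap a b"
      using \<open>up_step n (\<lambda>a. - int (T a)) U V\<close> unfolding up_step_def by auto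
    moreover have "U = V \<circ> swap b a" using ab(5) by (simp add: Transposition.transpose_commute)
    moreover have "V b < V a" using ab by (simp add: swap_apply)
    ultimately show ?thesis unfolding up_step_def by blast
  qed
  have revs: "(up_step n T)\<^sup>*\<^sup>* V U" if "(up_step n (\<lambda>a. - int (T a)))\<^sup>*\<^sup>* U V" for U V
    using that by (induction) (auto intro: converse_rtranclp_into_rtranclp rev)
  have "inj_on (\<lambda>a. - int (T a)) {1..n}"
    by (intro inj_onI) (use inj_onD[OF permutes_inj_on[OF assms(1), of "{1..n}"]] in simp)
  from below_has_greatest[OF this assms(2)] show ?thesis using revs by blast
qed

section \<open>Weak order\<close>

text \<open>
  Covers of the right weak order: two values \<open>a < b\<close> in adjacent positions of \<open>T\<close> are exchanged. When
  permutations are read as chambers of the braid arrangement, this crosses one wall.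
\<close>
definition weak_cover :: "nat \<Rightarrow> (nat \<Rightarrow> nat) \<Rightarrow> (nat \<Rightarrow> nat) \<Rightarrow> bool" where
  "weak_cover n T S \<longleftrightarrow> T permutes {1..n} \<and>
     (\<exists>a\<in>{1..n}. \<exists>b\<in>{1..n}. a < b \<and> T b = Suc (T a) \<and> S = T \<circ> swap a b)"

lemma weak_coverI:
  assumes "T permutes {1..n}" "a \<in> {1..n}" "b \<in> {1..n}" "a < b" "T b = Suc (T a)"
  shows "weak_cover n T (T \<circ> swap a b)"
  using assms unfolding weak_cover_def by blast

lemma weak_cover_permutes: "weak_cover n T S \<Longrightarrow> S permutes {1..n}"
  unfolding weak_cover_def using permutes_swap_comp by blast

lemma weak_covers_permutes: "(weak_cover n)\<^sup>*\<^sup>* T S \<Longrightarrow> T permutes {1..n} \<Longrightarrow> S permutes {1..n}"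
  by (induction rule: rtranclp_induct) (blast intro: weak_cover_permutes)+

lemma permutes_neq: "T permutes (X :: nat set) \<Longrightarrow> a \<noteq> b \<Longrightarrow> T a \<noteq> T b"
  by (metis permutes_def)

lemma inversions_adjacent_swap:
  assumes T: "T permutes {1..n}" and ab: "a \<in> {1..n}" "b \<in> {1..n}" "a < b" "T b = Suc (T a)"
  shows "inversions n (T \<circ> swap a b) = insert (a, b) (inversions n T)"
proof -
  have *: "T c \<noteq> T a" if "c \<noteq> a" for c using permutes_neq[OF T that] .
  have **: "T c \<noteq> Suc (T a)" if "c \<noteq> b" for c using permutes_neq[OF T that] ab by simp
  have "(p, q) \<in> inversions n (T \<circ> swap a b) \<longleftrightarrow> (p, q) \<in> insert (a, b) (inversions n T)" for p q
  proof (cases "p \<in> {1..n} \<and> q \<in> {1..n} \<and> p < q")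
    case True
    have "T p \<noteq> T q" using True permutes_neq[OF T, of p q] by simp
    then show ?thesis
      using True ab *[of p] *[of q] **[of p] **[of q]
      by (auto simp: inversions_def swap_apply)
  qed (use ab in \<open>auto simp: inversions_def\<close>)
  then show ?thesis by auto
qed

text \<open>
  Otherwise \<open>S \<circ> inv T\<close> has no descent and is the identity. This lets one walk from the ranking \<open>T\<close>
  to the ranking \<open>S\<close> by exchanging neighbours, each time removing a disagreement.
\<close>
lemma adjacent_disagreement:
  assumes T: "T permutes {1..n::nat}" and S: "S permutes {1..n}" and ne: "T \<noteq> S"
  shows "\<exists>a\<in>{1..n}. \<exists>b\<in>{1..n}. T b = Suc (T a) \<and> S b < S a"
proof (rule ccontr)
  assume none: "\<not> ?thesis"
  define P where "P = S \<circ> inv T"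
  have P: "P permutes {1..n}"
    unfolding P_def by (intro permutes_compose permutes_inv S T)
  have "\<not> P (Suc k) < P k" if "k \<in> {1..<n}" for k
  proof
    assume less: "P (Suc k) < P k"
    have "inv T k \<in> {1..n}" "inv T (Suc k) \<in> {1..n}"
      using that permutes_in_image[OF permutes_inv[OF T]] by auto
    moreover have "T (inv T k) = k" "T (inv T (Suc k)) = Suc k"
      using T by (simp_all add: permutes_inverses)
    ultimately show False
      using none less unfolding P_def by (metis comp_apply)
  qed
  then have "P = id"
    using increasing_if_no_descent[OF permutes_inj_on[OF P]] permutes_increasing_imp_id[OF P]
    by blast
  then have "S \<circ> inv T \<circ> T = T" by (simp add: P_def)
  then have "S = T" using T by (metis comp_assoc comp_id permutes_inv_o(2))
  with ne show False by simp
qed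

text \<open>
  Neighbours in \<open>T\<close> on which \<open>T\<close> and \<open>S\<close> disagree are inverted in \<open>S\<close> but not in \<open>T\<close>, so exchanging
  them is a weak cover that stays below \<open>S\<close>.
\<close>
lemma weak_covers_if_inversions_subset:
  assumes "T permutes {1..n}" "S permutes {1..n}" "inversions n T \<subseteq> inversions n S"
  shows "(weak_cover n)\<^sup>*\<^sup>* T S"
  using assms
proof (induction "card (inversions n S - inversions n T)" arbitrary: T rule: less_induct)
  case less
  show ?case
  proof (cases "T = S")
    case False
    then obtain a b where ab: "a \<in> {1..n}" "b \<in> {1..n}" "T b = Suc (T a)" "S b < S a"
      using adjacent_disagreement less.prems by blast
    have "\<not> b < a"
    proof
      assume "b < a"
      then have "(b, a) \<in> inversions n T" using ab by (simp add: inversions_def)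
      then have "(b, a) \<in> inversions n S" using less.prems by blast
      then show False using ab by (simp add: inversions_def)
    qed
    moreover have "a \<noteq> b" using ab by auto
    ultimately have "a < b" by simp
    let ?T = "T \<circ> swap a b"
    have inv: "inversions n ?T = insert (a, b) (inversions n T)"
      using inversions_adjacent_swap less.prems(1) ab(1-3) \<open>a < b\<close> by blast
    have mem: "(a, b) \<in> inversions n S - inversions n T"
      using ab \<open>a < b\<close> by (simp add: inversions_def)
    have "(weak_cover n)\<^sup>*\<^sup>* ?T S"
    proof (rule less.hyps)
      show "card (inversions n S - inversions n ?T) < card (inversions n S - inversions n T)"
        unfolding inv using mem by (intro psubset_card_mono) (auto simp: finite_inversions)
      show "?T permutes {1..n}" using less.prems(1) ab by (intro permutes_swap_comp)
      show "inversions n ?T \<subseteq> inversions n S" unfolding inv using less.prems mem by simp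
    qed (rule less.prems)
    moreover have "weak_cover n T ?T" using weak_coverI less.prems(1) ab(1-3) \<open>a < b\<close> by blast
    ultimately show ?thesis by (meson converse_rtranclp_into_rtranclp)
  qed simp
qed

lemma weak_cover_inversions:
  assumes "weak_cover n T S"
  shows "inversions n T \<subset> inversions n S"
proof -
  obtain a b where T: "T permutes {1..n}" and ab: "a \<in> {1..n}" "b \<in> {1..n}" "a < b"
    "T b = Suc (T a)" "S = T \<circ> swap a b"
    using assms unfolding weak_cover_def by blast
  moreover have "(a, b) \<notin> inversions n T" using ab by (simp add: inversions_def)
  ultimately show ?thesis using inversions_adjacent_swap[OF T ab(1-4)] by auto
qed

lemma weak_corank_decreases:
  assumes "weak_cover n T S"
  shows "n * n - card (inversions n S) < n * n - card (inversions n T)"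
proof -
  have "card (inversions n T) < card (inversions n S)"
    using weak_cover_inversions[OF assms] by (intro psubset_card_mono finite_inversions)
  moreover have "card (inversions n S) \<le> n * n"
    using card_mono[of "{1..n} \<times> {1..n}" "inversions n S"] by (fastforce simp: inversions_def)
  ultimately show ?thesis by simp
qed

lemma weak_covers_inversions:
  "(weak_cover n)\<^sup>*\<^sup>* T S \<Longrightarrow> inversions n T \<subseteq> inversions n S"
  by (induction rule: rtranclp_induct) (use weak_cover_inversions in blast)+

lemma weak_covers_from_identity:
  assumes "T permutes {1..n}"
  shows "(weak_cover n)\<^sup>*\<^sup>* (\<lambda>a. a) T"
proof (rule weak_covers_if_inversions_subset[OF _ assms])
  show "(\<lambda>a. a) permutes {1..n}" using permutes_id by (simp add: id_def)
  show "inversions n (\<lambda>a. a) \<subseteq> inversions n T" by (auto simp: inversions_def)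
qed

lemma weak_cover_imp_bruhat_step: "weak_cover n T S \<Longrightarrow> bruhat_step n T S"
  unfolding weak_cover_def up_step_def by (metis lessI)

lemma adjacent_swap_order:
  assumes T: "T permutes (X :: nat set)" and adj: "T b = Suc (T a)"
    and less: "(T \<circ> swap a b) x < (T \<circ> swap a b) y"
  shows "T x < T y \<or> x = b \<and> y = a"
proof -
  have ne: "T z \<noteq> T a" "T z \<noteq> Suc (T a)" if "z \<noteq> a" "z \<noteq> b" for z
    using permutes_neq[OF T] that adj by metis+
  consider "x = a" | "x = b" | "x \<noteq> a" "x \<noteq> b" by blast
  then show ?thesis
  proof cases
    case 3
    then show ?thesis using less adj ne[of x] by (auto simp: swap_apply split: if_splits)
  qed (use less adj ne[of y] in \<open>auto simp: swap_apply split: if_splits\<close>)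
qed

text \<open>
  Coefficients on the wall between the chambers of \<open>T\<close> and \<open>T \<circ> swap a b\<close>: \<open>b\<close> receives the rank of its
  predecessor \<open>a\<close>.
\<close>
definition merged :: "(nat \<Rightarrow> nat) \<Rightarrow> nat \<Rightarrow> nat \<Rightarrow> nat \<Rightarrow> real" where
  "merged T a b c = real (if c = b then T a else T c)"

lemma merged_mono: "T b = Suc (T a) \<Longrightarrow> T c < T d \<Longrightarrow> merged T a b c \<le> merged T a b d"
  by (auto simp: merged_def)

text \<open>
  On the wall only \<open>a\<close> and \<open>b\<close> have equal coefficients, so a chain with constant pairing is at most the
  single exchange of \<open>a\<close> and \<open>b\<close>.
\<close>
lemma up_steps_within_wall:
  assumes T: "T permutes {1..n}" and adj: "T b = Suc (T a)"
    and steps: "(up_step n T)\<^sup>*\<^sup>* U V"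
    and le: "pairing n (merged T a b) U \<le> pairing n (merged T a b) V"
  shows "V = U \<or> U a < U b \<and> V = U \<circ> swap a b"
proof -
  have "(\<lambda>U V. U a < U b \<and> V = U \<circ> swap a b)\<^sup>*\<^sup>* U V"
  proof (rule up_steps_within_level_sets[OF steps merged_mono[of T b a, OF adj] le])
    fix X :: "nat \<Rightarrow> nat" and c d
    assume *: "T c < T d" "merged T a b c = merged T a b d" "X c < X d"
    then have "c = a \<and> d = b"
      using adj permutes_neq[OF T, of c a] permutes_neq[OF T, of d a]
      by (auto simp: merged_def split: if_splits)
    then show "X a < X b \<and> X \<circ> swap c d = X \<circ> swap a b" using * by simp
  qed
  then show ?thesis by (induction) (auto simp: swap_apply)
qed

text \<open>
  All vertices lie on one sphere around the origin, so each of them is the unique maximum of its own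
  functional. The proof expands the squared distance of the two points.
\<close>
lemma pairing_self_less:
  assumes Up: "U permutes {1..n}" and Xp: "X permutes {1..n}" and "X \<noteq> U"
  shows "pairing n (\<lambda>a. real (U a)) X < pairing n (\<lambda>a. real (U a)) U"
proof (rule ccontr)
  assume "\<not> ?thesis"
  then have "pairing n (\<lambda>a. real (U a)) U \<le> pairing n (\<lambda>a. real (U a)) X" by simp
  moreover have "(\<Sum>a\<in>{1..n}. real (X a) * real (X a)) = (\<Sum>a\<in>{1..n}. real (U a) * real (U a))"
    using sum.permute[OF Xp, of "\<lambda>a. real a * real a"] sum.permute[OF Up, of "\<lambda>a. real a * real a"]
    by (simp add: comp_def)
  moreover have "(\<Sum>a\<in>{1..n}. (real (U a) - real (X a))\<^sup>2) =
      (\<Sum>a\<in>{1..n}. real (U a) * real (U a)) + (\<Sum>a\<in>{1..n}. real (X a) * real (X a))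
      - 2 * (\<Sum>a\<in>{1..n}. real (U a) * real (X a))"
    unfolding sum_distrib_left sum.distrib[symmetric] sum_subtractf[symmetric]
    by (intro sum.cong) (simp_all add: power2_eq_square algebra_simps)
  ultimately have "(\<Sum>a\<in>{1..n}. (real (U a) - real (X a))\<^sup>2) \<le> 0"
    unfolding pairing_def by linarith
  then have "(\<Sum>a\<in>{1..n}. (real (U a) - real (X a))\<^sup>2) = 0"
    by (intro antisym sum_nonneg) simp_all
  then have "\<forall>a\<in>{1..n}. (real (U a) - real (X a))\<^sup>2 = 0"
    by (subst (asm) sum_nonneg_eq_0_iff) simp_all
  then have "U a = X a" if "a \<in> {1..n}" for a using that by simp
  then have "U = X" using Up Xp by (intro ext) (metis permutes_not_in)
  then show False using \<open>X \<noteq> U\<close> by simp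
qed

section \<open>The vertex of a chamber\<close>

locale bruhat_ideal =
  fixes n :: nat and W :: "nat \<Rightarrow> nat"
  assumes W: "W permutes {1..n}"
begin

abbreviation A :: "(nat \<Rightarrow> nat) set" where
  "A \<equiv> below n W"

text \<open>
  The vertex that belongs to the chamber of \<open>T\<close>: the point at which the functionals increasing with \<open>T\<close>
  are maximal.
\<close>
definition vertex :: "(nat \<Rightarrow> nat) \<Rightarrow> (nat \<Rightarrow> nat)" where
  "vertex T = (SOME U. U \<in> A \<and> (\<forall>Y\<in>A. (up_step n T)\<^sup>*\<^sup>* U Y))"

lemma A_permutes: "U \<in> A \<Longrightarrow> U permutes {1..n}"
  by (simp add: below_def)

lemma A_down: "U \<in> A \<Longrightarrow> V permutes {1..n} \<Longrightarrow> (bruhat_step n)\<^sup>*\<^sup>* V U \<Longrightarrow> V \<in> A"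
  unfolding below_def using rtranclp_trans by fastforce

lemma finite_A: "finite A"
  by (rule finite_subset[OF _ finite_permutations[of "{1..n}"]]) (auto simp: below_def)

lemma vertex_least:
  assumes "T permutes {1..n}"
  shows "vertex T \<in> A" and "Y \<in> A \<Longrightarrow> (up_step n T)\<^sup>*\<^sup>* (vertex T) Y"
proof -
  have "\<exists>U. U \<in> A \<and> (\<forall>Y\<in>A. (up_step n T)\<^sup>*\<^sup>* U Y)" using below_has_least[OF assms W] by blast
  then have "vertex T \<in> A \<and> (\<forall>Y\<in>A. (up_step n T)\<^sup>*\<^sup>* (vertex T) Y)"
    unfolding vertex_def by (rule someI_ex)
  then show "vertex T \<in> A" and "Y \<in> A \<Longrightarrow> (up_step n T)\<^sup>*\<^sup>* (vertex T) Y" by auto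
qed

text \<open>
  Crossing a wall. The vertices of the two chambers both maximise the functional on the wall
  between them, so they differ at most by the exchange of \<open>a\<close> and \<open>b\<close>; and the exchange takes place as
  soon as it improves the vertex for the new ranking and stays in the interval.
\<close>
lemma vertex_adjacent_swap:
  assumes T: "T permutes {1..n}" and ab: "a \<in> {1..n}" "b \<in> {1..n}" "T b = Suc (T a)"
  shows "vertex (T \<circ> swap a b) =
    (if vertex T a < vertex T b \<and> vertex T \<circ> swap a b \<in> A then vertex T \<circ> swap a b else vertex T)"
proof -
  let ?T = "T \<circ> swap a b"
  define U where "U = vertex T"
  define V where "V = vertex ?T"
  have T': "?T permutes {1..n}" using T ab by (intro permutes_swap_comp)
  note U = vertex_least[OF T, folded U_def] and V = vertex_least[OF T', folded V_def]
  have "merged T a b c \<le> merged T a b d" if "?T c < ?T d" for c d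
    using adjacent_swap_order[OF T ab(3) that]
  proof
    assume "T c < T d"
    then show ?thesis by (rule merged_mono[of T b a, OF ab(3)])
  qed (simp add: merged_def)
  then have "pairing n (merged T a b) U \<le> pairing n (merged T a b) V"
    by (intro pairing_up_steps[OF V(2)[OF U(1)]])
  then have VU: "V = U \<or> U a < U b \<and> V = U \<circ> swap a b"
    by (rule up_steps_within_wall[OF T ab(3) U(2)[OF V(1)]])
  have "V \<noteq> U" if "U a < U b" "U \<circ> swap a b \<in> A"
  proof
    assume "V = U"
    have "up_step n ?T (U \<circ> swap a b) (U \<circ> swap a b \<circ> swap b a)"
      using that(1) ab by (intro up_step_swap) (auto simp: swap_apply)
    then have "(up_step n ?T)\<^sup>*\<^sup>* (U \<circ> swap a b) V"
      by (simp add: \<open>V = U\<close> Transposition.transpose_commute[of b a])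
    then have "U \<circ> swap a b = U"
      using V(2)[OF that(2)] up_steps_antisym \<open>V = U\<close> by blast
    then show False using that(1) by (metis comp_apply less_irrefl swap_apply)
  qed
  then show ?thesis using VU V(1) unfolding U_def[symmetric] V_def[symmetric] by auto
qed

text \<open>
  If \<open>T\<close> refines \<open>f\<close> and breaks its ties according to \<open>U\<close>, then \<open>U\<close> is the vertex of \<open>T\<close> as soon as it
  maximises \<open>f\<close>: the chamber of \<open>T\<close> is the one entered when \<open>f\<close> is perturbed towards \<open>U\<close>.
\<close>
lemma vertex_eqI:
  assumes T: "T permutes {1..n}" and U: "U \<in> A"
    and f: "\<And>a b. a \<in> {1..n} \<Longrightarrow> b \<in> {1..n} \<Longrightarrow> T a < T b \<Longrightarrow> f a \<le> f b"
    and fU: "\<And>a b. a \<in> {1..n} \<Longrightarrow> b \<in> {1..n} \<Longrightarrow> T a < T b \<Longrightarrow> f a = f b \<Longrightarrow> U a < U b"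
    and max: "pairing n f (vertex T) \<le> pairing n f U"
  shows "vertex T = U"
proof -
  define X where "X = vertex T"
  note X = vertex_least[OF T, folded X_def]
  have Up: "U permutes {1..n}" and Xp: "X permutes {1..n}" using U X A_permutes by auto
  have "(up_step n U)\<^sup>*\<^sup>* X U"
    by (rule up_steps_within_level_sets[OF X(2)[OF U] f max[folded X_def]])
      (assumption | intro up_step_swap fU)+
  then have "pairing n (\<lambda>a. real (U a)) U \<le> pairing n (\<lambda>a. real (U a)) X"
    by (rule pairing_up_steps) simp
  then show ?thesis using pairing_self_less[OF Up Xp] by (fastforce simp: X_def)
qed

lemma vertex_self:
  assumes "T \<in> A"
  shows "vertex T = T"
  by (rule vertex_eqI[where f = "\<lambda>_. 0"]) (use assms A_permutes in \<open>auto simp: pairing_def\<close>)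

text \<open>
  Three values \<open>a < c < b\<close> in the order \<open>a c b\<close>: both \<open>c a b\<close> and \<open>a b c\<close> are below \<open>b c a\<close>.
\<close>
lemma bruhat_between:
  assumes "a \<in> {1..n}" "b \<in> {1..n}" "a < c" "c < b" "U a < U c" "U c < U b"
  shows "(bruhat_step n)\<^sup>*\<^sup>* (U \<circ> swap a c) (U \<circ> swap a b)"
    and "(bruhat_step n)\<^sup>*\<^sup>* (U \<circ> swap c b) (U \<circ> swap a b)"
proof -
  have c: "c \<in> {1..n}" using assms by auto
  let ?X = "U \<circ> swap a c" and ?Y = "U \<circ> swap c b"
  have "bruhat_step n ?X (?X \<circ> swap a b)"
       "bruhat_step n (?X \<circ> swap a b) (?X \<circ> swap a b \<circ> swap c b)"
       "bruhat_step n ?Y (?Y \<circ> swap a b)"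
       "bruhat_step n (?Y \<circ> swap a b) (?Y \<circ> swap a b \<circ> swap a c)"
    by (rule up_step_swap; use assms c in \<open>simp add: swap_apply\<close>)+
  moreover have "?X \<circ> swap a b \<circ> swap c b = U \<circ> swap a b"
    "?Y \<circ> swap a b \<circ> swap a c = U \<circ> swap a b"
    using assms by (auto simp: fun_eq_iff swap_apply)
  ultimately show "(bruhat_step n)\<^sup>*\<^sup>* ?X (U \<circ> swap a b)" "(bruhat_step n)\<^sup>*\<^sup>* ?Y (U \<circ> swap a b)"
    by (metis converse_rtranclp_into_rtranclp rtranclp.rtrancl_refl)+
qed

text \<open>
  Such an exchange would produce an element that the ranking \<open>T\<close> prefers to the least one.
\<close>
lemma no_swap_against_vertex:
  assumes T: "T permutes {1..n}" and ab: "a \<in> {1..n}" "b \<in> {1..n}" "T a < T b"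
    and less: "vertex T b < vertex T a"
  shows "vertex T \<circ> swap a b \<notin> A"
proof
  let ?U = "vertex T"
  assume *: "?U \<circ> swap a b \<in> A"
  have "up_step n T (?U \<circ> swap a b) (?U \<circ> swap a b \<circ> swap a b)"
    using ab less by (intro up_step_swap) (auto simp: swap_apply)
  then have "(up_step n T)\<^sup>*\<^sup>* (?U \<circ> swap a b) ?U" by simp
  then have "?U \<circ> swap a b = ?U" using vertex_least(2)[OF T *] up_steps_antisym by blast
  then show False using less by (metis comp_apply less_irrefl swap_apply)
qed

text \<open>
  Induction along weak order from the identity. The only danger in a step that exchanges \<open>a\<close> and \<open>b\<close>
  is a value \<open>a < c < b\<close> placed between them in the vertex \<open>U\<close>. Then the exchanges of \<open>a, c\<close> and of \<open>c, b\<close>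
  remain in the interval too, and since \<open>a\<close> and \<open>b\<close> are neighbours in the ranking, one of them
  gives an element that the ranking prefers to \<open>U\<close>.
\<close>
lemma inversions_vertex_subset:
  assumes "T permutes {1..n}"
  shows "inversions n (vertex T) \<subseteq> inversions n T"
  using weak_covers_from_identity[OF assms]
proof (induction)
  case base
  have "(bruhat_step n)\<^sup>*\<^sup>* (\<lambda>a. a) W"
    by (rule rtranclp_mono[THEN predicate2D, OF _ weak_covers_from_identity[OF W]])
      (use weak_cover_imp_bruhat_step in blast)
  then have "(\<lambda>a. a) \<in> A"
    using permutes_id[of "{1..n}"] by (simp add: below_def id_def)
  then show ?case by (simp add: vertex_self)
next
  case (step T S)
  obtain a b where T: "T permutes {1..n}" and ab: "a \<in> {1..n}" "b \<in> {1..n}" "a < b"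
    "T b = Suc (T a)" and S: "S = T \<circ> swap a b"
    using step.hyps(2) unfolding weak_cover_def by blast
  define U where "U = vertex T"
  have Up: "U permutes {1..n}" using vertex_least(1)[OF T] A_permutes by (simp add: U_def)
  have inv_S: "inversions n S = insert (a, b) (inversions n T)"
    unfolding S by (rule inversions_adjacent_swap[OF T ab])
  show ?case
  proof (cases "vertex S = U")
    case True
    then show ?thesis using step.IH inv_S by (auto simp: U_def)
  next
    case False
    define V where "V = U \<circ> swap a b"
    have V: "vertex S = V" "V \<in> A" and Uab: "U a < U b"
      using False vertex_adjacent_swap[OF T ab(1,2,4)] unfolding S V_def U_def
      by (auto split: if_splits)
    have IH: "T q < T p" if "p \<in> {1..n}" "q \<in> {1..n}" "p < q" "U q < U p" for p q
      using subsetD[OF step.IH, of "(p, q)"] that by (simp add: inversions_def U_def)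
    have none: "\<not> (U a < U c \<and> U c < U b)" if c: "a < c" "c < b" for c
    proof
      assume Uc: "U a < U c \<and> U c < U b"
      have cn: "c \<in> {1..n}" using c ab by auto
      have "U \<circ> swap a c \<in> A" "U \<circ> swap c b \<in> A"
        using bruhat_between[of a b c U] Uc c ab(1,2) cn V(2) Up permutes_swap_comp unfolding V_def
        by (auto intro!: A_down[of "U \<circ> swap a b"])
      then have "\<not> T c < T a" "\<not> T b < T c"
        using no_swap_against_vertex[OF T cn ab(1)] no_swap_against_vertex[OF T ab(2) cn] Uc
        unfolding U_def by (auto simp: Transposition.transpose_commute)
      moreover have "T c \<noteq> T a" "T c \<noteq> T b" using permutes_neq[OF T] c by auto
      ultimately show False using ab by auto
    qed
    have "(p, q) \<in> inversions n S" if "(p, q) \<in> inversions n V" for p q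
    proof -
      have pq: "p \<in> {1..n}" "q \<in> {1..n}" "p < q" "V q < V p" using that by (auto simp: inversions_def)
      have up: "U q < U p \<Longrightarrow> T q < T p" using IH[OF pq(1-3)] .
      have V': "V p = (if p = a then U b else if p = b then U a else U p)"
        "V q = (if q = a then U b else if q = b then U a else U q)"
        by (simp_all add: V_def swap_apply)
      consider "p = a" "q = b" | "p = a" "q \<noteq> b" | "p = b" | "q = a" | "q = b" "p \<noteq> a"
        | "{p, q} \<inter> {a, b} = {}" by auto
      then have "p = a \<and> q = b \<or> T q < T p"
      proof cases
        case 2
        then have "q \<noteq> a" "U q < U b" using pq V' by auto
        moreover have "T q \<noteq> T a" "U q \<noteq> U a"
          using \<open>q \<noteq> a\<close> permutes_neq[OF T] permutes_neq[OF Up] by blast+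
        ultimately show ?thesis
          using up none[of q] IH[of b q] 2 pq ab
          by (cases "U q < U a"; cases "q < b") auto
      next
        case 3
        then show ?thesis using pq V' ab IH[of a q] Uab by auto
      next
        case 4
        then show ?thesis using pq V' ab IH[of p b] up Uab by auto
      next
        case 5
        then have "p \<noteq> b" "U a < U p" using pq V' ab by (auto split: if_splits)
        moreover have "T p \<noteq> T b" "U p \<noteq> U b"
          using \<open>p \<noteq> b\<close> permutes_neq[OF T] permutes_neq[OF Up] by blast+
        ultimately show ?thesis
          using up none[of p] IH[of p a] 5 pq ab
          by (cases "U b < U p"; cases "a < p") auto
      qed (use pq up V' in auto)
      then show ?thesis unfolding inv_S using pq by (auto simp: inversions_def)
    qed
    then show ?thesis using V(1) by auto
  qed
qed
end

section \<open>Confluence and meets in weak order\<close>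

text \<open>
  Newman's lemma for two commuting relations; \<open>r = s\<close> is the classical statement on confluence.
\<close>
lemma local_commutation_imp_commutation:
  fixes m :: "'a \<Rightarrow> nat"
  assumes decr: "\<And>x y. r x y \<or> s x y \<Longrightarrow> m y < m x"
    and local: "\<And>x y z. r x y \<Longrightarrow> s x z \<Longrightarrow> \<exists>t. s\<^sup>*\<^sup>* y t \<and> r\<^sup>*\<^sup>* z t"
    and "r\<^sup>*\<^sup>* x y" "s\<^sup>*\<^sup>* x z"
  shows "\<exists>t. s\<^sup>*\<^sup>* y t \<and> r\<^sup>*\<^sup>* z t"
  using assms(3,4)
proof (induction "m x" arbitrary: x y z rule: less_induct)
  case less
  show ?case
  proof (cases "x = y \<or> x = z")
    case True
    then show ?thesis using less.prems by blast
  next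
    case False
    then obtain y1 z1 where y1: "r x y1" "r\<^sup>*\<^sup>* y1 y" and z1: "s x z1" "s\<^sup>*\<^sup>* z1 z"
      using less.prems by (metis converse_rtranclpE)
    obtain t1 where t1: "s\<^sup>*\<^sup>* y1 t1" "r\<^sup>*\<^sup>* z1 t1" using local[OF y1(1) z1(1)] by blast
    obtain t2 where t2: "s\<^sup>*\<^sup>* y t2" "r\<^sup>*\<^sup>* t1 t2" using less.hyps[OF _ y1(2) t1(1)] decr y1(1) by blast
    obtain t3 where "s\<^sup>*\<^sup>* t2 t3" "r\<^sup>*\<^sup>* z t3"
      using less.hyps[OF _ rtranclp_trans[OF t1(2) t2(2)] z1(2)] decr z1(1) by blast
    then show ?thesis using t2(1) by (meson rtranclp_trans)
  qed
qed

lemma directed_has_greatest: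
  assumes "finite F" "F \<noteq> {}"
    and dir: "\<And>x y. x \<in> F \<Longrightarrow> y \<in> F \<Longrightarrow> \<exists>t\<in>F. h x \<subseteq> h t \<and> h y \<subseteq> h t"
  shows "\<exists>m\<in>F. \<forall>x\<in>F. h x \<subseteq> h m"
proof -
  obtain m where m: "m \<in> F" "\<And>x. x \<in> F \<Longrightarrow> h m \<subseteq> h x \<Longrightarrow> h m = h x"
    using finite_has_maximal[of "h ` F"] assms(1,2) by auto
  have "h x \<subseteq> h m" if "x \<in> F" for x
    using dir[OF m(1) that] m(2) by blast
  then show ?thesis using m(1) by blast
qed

text \<open>
  Three values \<open>p < q < r\<close> in consecutive positions span an interval of weak order with two maximal
  chains, through \<open>q p r\<close>, \<open>q r p\<close> and through \<open>p r q\<close>, \<open>r p q\<close>, which meet in \<open>r q p\<close>.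
\<close>
lemma weak_hexagon:
  assumes T: "T permutes {1..n}" and p: "p \<in> {1..n}" and r: "r \<in> {1..n}"
    and lt: "p < q" "q < r" and adj: "T q = Suc (T p)" "T r = Suc (T q)"
  shows "weak_cover n (T \<circ> swap p q) (T \<circ> swap p q \<circ> swap p r)"
    and "weak_cover n (T \<circ> swap p q \<circ> swap p r) (T \<circ> swap p r)"
    and "weak_cover n (T \<circ> swap q r) (T \<circ> swap q r \<circ> swap p r)"
    and "weak_cover n (T \<circ> swap q r \<circ> swap p r) (T \<circ> swap p r)"
proof -
  have q: "q \<in> {1..n}" using lt p r by auto
  note perm = permutes_swap_comp[OF T] permutes_swap_comp[OF permutes_swap_comp[OF T]]
  show "weak_cover n (T \<circ> swap p q) (T \<circ> swap p q \<circ> swap p r)"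
    "weak_cover n (T \<circ> swap q r) (T \<circ> swap q r \<circ> swap p r)"
    by (rule weak_coverI; use p q r lt adj perm in \<open>simp add: swap_apply\<close>)+
  have "weak_cover n (T \<circ> swap p q \<circ> swap p r) (T \<circ> swap p q \<circ> swap p r \<circ> swap q r)"
    "weak_cover n (T \<circ> swap q r \<circ> swap p r) (T \<circ> swap q r \<circ> swap p r \<circ> swap p q)"
    by (rule weak_coverI; use p q r lt adj perm in \<open>simp add: swap_apply\<close>)+
  moreover have "T \<circ> swap p q \<circ> swap p r \<circ> swap q r = T \<circ> swap p r"
    "T \<circ> swap q r \<circ> swap p r \<circ> swap p q = T \<circ> swap p r"
    using lt by (auto simp: fun_eq_iff swap_apply)
  ultimately show "weak_cover n (T \<circ> swap p q \<circ> swap p r) (T \<circ> swap p r)"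
    "weak_cover n (T \<circ> swap q r \<circ> swap p r) (T \<circ> swap p r)" by simp_all
qed

lemma weak_square:
  assumes T: "T permutes {1..n}" and ab: "a \<in> {1..n}" "b \<in> {1..n}" "a < b" "T b = Suc (T a)"
    and cd: "c \<in> {1..n}" "d \<in> {1..n}" "c < d" "T d = Suc (T c)" and disj: "{a, b} \<inter> {c, d} = {}"
  shows "weak_cover n (T \<circ> swap a b) (T \<circ> swap a b \<circ> swap c d)"
    and "T \<circ> swap a b \<circ> swap c d = T \<circ> swap c d \<circ> swap a b"
proof -
  show "weak_cover n (T \<circ> swap a b) (T \<circ> swap a b \<circ> swap c d)"
    by (rule weak_coverI; use ab cd disj permutes_swap_comp[OF T] in \<open>auto simp: swap_apply\<close>)
  show "T \<circ> swap a b \<circ> swap c d = T \<circ> swap c d \<circ> swap a b"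
    using disj by (auto simp: fun_eq_iff swap_apply)
qed

lemma weak_cover_pair_cases:
  assumes "weak_cover n T Y" "weak_cover n T Z"
  obtains (equal) "Y = Z"
  | (square) a b c d where "a \<in> {1..n}" "b \<in> {1..n}" "a < b" "T b = Suc (T a)"
      "c \<in> {1..n}" "d \<in> {1..n}" "c < d" "T d = Suc (T c)" "{a, b} \<inter> {c, d} = {}"
      "Y = T \<circ> swap a b" "Z = T \<circ> swap c d"
  | (hexagon) p q r where "p \<in> {1..n}" "q \<in> {1..n}" "r \<in> {1..n}" "p < q" "q < r"
      "T q = Suc (T p)" "T r = Suc (T q)"
      "Y = T \<circ> swap p q \<and> Z = T \<circ> swap q r \<or> Y = T \<circ> swap q r \<and> Z = T \<circ> swap p q"
proof -
  obtain a b where T: "T permutes {1..n}" and ab: "a \<in> {1..n}" "b \<in> {1..n}" "a < b" "T b = Suc (T a)"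
    and Y: "Y = T \<circ> swap a b" using assms(1) unfolding weak_cover_def by blast
  obtain c d where cd: "c \<in> {1..n}" "d \<in> {1..n}" "c < d" "T d = Suc (T c)"
    and Z: "Z = T \<circ> swap c d" using assms(2) unfolding weak_cover_def by blast
  have inj: "T x = T y \<Longrightarrow> x = y" for x y using permutes_inj[OF T] by (auto dest: injD)
  consider "a = c" | "b = d" | "b = c" | "a = d" | "{a, b} \<inter> {c, d} = {}" by auto
  then show thesis
  proof cases
    case 1
    then have "b = d" using ab cd inj by simp
    then show thesis using 1 Y Z equal by simp
  next
    case 2
    then have "a = c" using ab cd inj by simp
    then show thesis using 2 Y Z equal by simp
  next
    case 3
    then show thesis using ab cd Y Z by (intro hexagon[of a b d]) auto
  next
    case 4
    then show thesis using ab cd Y Z by (intro hexagon[of c a b]) auto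
  next
    case 5
    then show thesis using ab cd Y Z by (intro square)
  qed
qed

text \<open>
  The top of the square or hexagon spanned by two covers is their join, because inversion sets are
  transitive: with \<open>(p, q)\<close> and \<open>(q, r)\<close> also \<open>(p, r)\<close> is inverted.
\<close>
lemma weak_polygon_below:
  assumes "weak_cover n T Y" "weak_cover n T Z"
  shows "\<exists>t. (weak_cover n)\<^sup>*\<^sup>* Y t \<and> (weak_cover n)\<^sup>*\<^sup>* Z t \<and>
    (\<forall>S :: nat \<Rightarrow> nat. inversions n Y \<subseteq> inversions n S \<and> inversions n Z \<subseteq> inversions n S \<longrightarrow>
         inversions n t \<subseteq> inversions n S)"
  using assms
proof (cases rule: weak_cover_pair_cases)
  case equal
  then show ?thesis by blast
next
  case (square a b c d)
  have T: "T permutes {1..n}" using assms(1) by (simp add: weak_cover_def)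
  let ?t = "T \<circ> swap a b \<circ> swap c d"
  have Yt: "weak_cover n Y ?t"
    using weak_square[OF T square(1-9)] square(10) by simp
  have Zt: "weak_cover n Z ?t"
    using weak_square(1)[OF T square(5-8) square(1-4)] weak_square(2)[OF T square(1-9)] square(9,11) by auto
  have Y: "Y permutes {1..n}" using weak_cover_permutes[OF assms(1)] .
  have "inversions n ?t = insert (c, d) (inversions n Y)"
    unfolding square(10) by (rule inversions_adjacent_swap)
      (use Y square in \<open>auto simp: swap_apply\<close>)
  moreover have "(c, d) \<in> inversions n Z"
    using square(5-8) unfolding square(11) by (simp add: inversions_def swap_apply)
  ultimately have "inversions n Y \<subseteq> inversions n S \<and> inversions n Z \<subseteq> inversions n S \<longrightarrow>
         inversions n ?t \<subseteq> inversions n S" for S :: "nat \<Rightarrow> nat" by auto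
  then show ?thesis using Yt Zt by blast
next
  case (hexagon p q r)
  have T: "T permutes {1..n}" using assms(1) by (simp add: weak_cover_def)
  note hex = weak_hexagon[OF T hexagon(1,3-7)]
  let ?t = "T \<circ> swap p r"
  have "(weak_cover n)\<^sup>*\<^sup>* (T \<circ> swap p q) ?t" "(weak_cover n)\<^sup>*\<^sup>* (T \<circ> swap q r) ?t"
    using hex by (meson rtranclp.rtrancl_into_rtrancl r_into_rtranclp)+
  moreover have "inversions n ?t \<subseteq> inversions n S"
    if S: "inversions n (T \<circ> swap p q) \<subseteq> inversions n S" "inversions n (T \<circ> swap q r) \<subseteq> inversions n S" for S :: "nat \<Rightarrow> nat"
  proof -
    let ?Y = "T \<circ> swap p q"
    have Yp: "?Y permutes {1..n}" using T hexagon by (intro permutes_swap_comp)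
    have Yp': "?Y \<circ> swap p r permutes {1..n}" by (rule permutes_swap_comp[OF Yp hexagon(1,3)])
    have "inversions n (?Y \<circ> swap p r) = insert (p, r) (inversions n ?Y)"
      by (rule inversions_adjacent_swap[OF Yp]) (use hexagon in \<open>auto simp: swap_apply\<close>)
    moreover have "inversions n (?Y \<circ> swap p r \<circ> swap q r) = insert (q, r) (inversions n (?Y \<circ> swap p r))"
      by (rule inversions_adjacent_swap[OF Yp']) (use hexagon in \<open>auto simp: swap_apply\<close>)
    moreover have "?Y \<circ> swap p r \<circ> swap q r = ?t"
      using hexagon(4,5) by (auto simp: fun_eq_iff swap_apply)
    ultimately have "inversions n ?t = {(q, r), (p, r)} \<union> inversions n ?Y" by auto
    moreover have "(p, q) \<in> inversions n S"
      using hexagon(1-7) by (intro subsetD[OF S(1)]) (simp add: inversions_def swap_apply)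
    moreover have "(q, r) \<in> inversions n S"
      using hexagon(1-7) by (intro subsetD[OF S(2)]) (simp add: inversions_def swap_apply)
    moreover have "(p, r) \<in> inversions n S" using calculation(2,3) by (auto simp: inversions_def)
    ultimately show ?thesis using S(1) by auto
  qed
  ultimately show ?thesis using hexagon(8) by blast
qed

text \<open>
  The common lower bounds of \<open>\<S>\<close> form a lower set that contains the top of each polygon spanned by
  two covers within it. By confluence it is directed, and being finite it has a greatest element.
\<close>
lemma weak_meet_exists:
  fixes \<S> :: "(nat \<Rightarrow> nat) set"
  shows "\<exists>m. m permutes {1..n} \<and> (\<forall>S\<in>\<S>. inversions n m \<subseteq> inversions n S) \<and>
    (\<forall>T. T permutes {1..n} \<and> (\<forall>S\<in>\<S>. inversions n T \<subseteq> inversions n S) \<longrightarrow> inversions n T \<subseteq> inversions n m)"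
proof -
  define J where "J = {T. T permutes {1..n} \<and> (\<forall>S\<in>\<S>. inversions n T \<subseteq> inversions n (S :: nat \<Rightarrow> nat))}"
  define r where "r T S \<longleftrightarrow> weak_cover n T S \<and> S \<in> J" for T S
  have J_down: "T \<in> J" if "(weak_cover n)\<^sup>*\<^sup>* T S" "T permutes {1..n}" "S \<in> J" for T S
    using that weak_covers_inversions[OF that(1)] by (auto simp: J_def)
  have path: "r\<^sup>*\<^sup>* T S" if "(weak_cover n)\<^sup>*\<^sup>* T S" "T permutes {1..n}" "S \<in> J" for T S
    using that
  proof (induction rule: converse_rtranclp_induct)
    case (step T Y)
    have "Y permutes {1..n}" using step.hyps(1) by (rule weak_cover_permutes)
    then have "r T Y" "r\<^sup>*\<^sup>* Y S"
      using step J_down[OF step.hyps(2)] unfolding r_def by blast+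
    then show ?case by (rule converse_rtranclp_into_rtranclp)
  qed simp
  have J_stays: "T \<in> J \<Longrightarrow> S \<in> J" if "r\<^sup>*\<^sup>* T S" for T S
    using that by (induction) (auto simp: r_def)
  have id: "(\<lambda>a. a) \<in> J"
    using permutes_id[of "{1..n}"] by (auto simp: J_def inversions_def id_def)
  have "\<exists>t\<in>J. inversions n Y \<subseteq> inversions n t \<and> inversions n Z \<subseteq> inversions n t"
    if "Y \<in> J" "Z \<in> J" for Y Z
  proof -
    have from_id: "r\<^sup>*\<^sup>* (\<lambda>a. a) X" if "X \<in> J" for X
      using that permutes_id[of "{1..n}"] weak_covers_from_identity[of X n]
      by (intro path) (auto simp: J_def id_def)
    have "\<exists>t. r\<^sup>*\<^sup>* Y t \<and> r\<^sup>*\<^sup>* Z t"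
    proof (rule local_commutation_imp_commutation[of r r "\<lambda>T. n * n - card (inversions n T)" "\<lambda>a. a" Y Z])
      fix T S
      assume "r T S \<or> r T S"
      then show "n * n - card (inversions n S) < n * n - card (inversions n T)"
        using weak_corank_decreases by (simp add: r_def)
    next
      fix T Y Z
      assume *: "r T Y" "r T Z"
      then obtain t where t: "(weak_cover n)\<^sup>*\<^sup>* Y t" "(weak_cover n)\<^sup>*\<^sup>* Z t"
        and le: "\<And>S :: nat \<Rightarrow> nat. inversions n Y \<subseteq> inversions n S \<Longrightarrow> inversions n Z \<subseteq> inversions n S \<Longrightarrow>
         inversions n t \<subseteq> inversions n S"
        using weak_polygon_below[of n T Y Z] unfolding r_def by blast
      have YZ: "Y \<in> J" "Z \<in> J" using * by (simp_all add: r_def)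
      have p: "Y permutes {1..n}" "Z permutes {1..n}" using YZ by (auto simp: J_def)
      have "t \<in> J"
        using YZ le weak_covers_permutes[OF t(1) p(1)] unfolding J_def by blast
      then show "\<exists>t. r\<^sup>*\<^sup>* Y t \<and> r\<^sup>*\<^sup>* Z t" using path[OF t(1) p(1)] path[OF t(2) p(2)] by blast
    qed (rule from_id[OF that(1)] from_id[OF that(2)])+
    then obtain t where t: "r\<^sup>*\<^sup>* Y t" "r\<^sup>*\<^sup>* Z t" by blast
    have "(weak_cover n)\<^sup>*\<^sup>* X t" if "r\<^sup>*\<^sup>* X t" for X
      using that by (rule rtranclp_mono[THEN predicate2D, rotated]) (auto simp: r_def)
    then have "inversions n Y \<subseteq> inversions n t" "inversions n Z \<subseteq> inversions n t"
      using t weak_covers_inversions by blast+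
    then show ?thesis using J_stays[OF t(1) \<open>Y \<in> J\<close>] by blast
  qed
  moreover have "finite J"
    by (rule finite_subset[OF _ finite_permutations[of "{1..n}"]]) (auto simp: J_def)
  ultimately obtain m where "m \<in> J" "\<forall>T\<in>J. inversions n T \<subseteq> inversions n m"
    using directed_has_greatest[of J "inversions n"] id by blast
  then show ?thesis unfolding J_def by blast
qed

section \<open>Fibres of the vertex map\<close>

context bruhat_ideal
begin

definition fibre_cover :: "(nat \<Rightarrow> nat) \<Rightarrow> (nat \<Rightarrow> nat) \<Rightarrow> bool" where
  "fibre_cover T S \<longleftrightarrow> weak_cover n T S \<and> vertex S = vertex T"

text \<open>
  The walls at which the vertex changes; these turn out to be the edges of the polytope, directed by
  increasing length.
\<close>
definition vertex_cover :: "(nat \<Rightarrow> nat) \<Rightarrow> (nat \<Rightarrow> nat) \<Rightarrow> bool" where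
  "vertex_cover U V \<longleftrightarrow> (\<exists>T S. weak_cover n T S \<and> vertex T = U \<and> vertex S = V \<and> U \<noteq> V)"

lemma vertex_permutes: "T permutes {1..n} \<Longrightarrow> vertex T permutes {1..n}"
  using vertex_least(1) A_permutes by blast

lemma vertex_noninversion:
  assumes T: "T permutes {1..n}" and ab: "a \<in> {1..n}" "b \<in> {1..n}" "a < b" "T a < T b"
  shows "vertex T a < vertex T b"
proof -
  have "(a, b) \<notin> inversions n (vertex T)"
  proof
    assume "(a, b) \<in> inversions n (vertex T)"
    then have "(a, b) \<in> inversions n T" using inversions_vertex_subset[OF T] by blast
    then show False using ab by (simp add: inversions_def)
  qed
  then have "\<not> vertex T b < vertex T a" using ab by (auto simp: inversions_def)
  moreover have "vertex T a \<noteq> vertex T b"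
    using permutes_neq[OF vertex_permutes[OF T], of a b] ab by simp
  ultimately show ?thesis by simp
qed

lemma vertex_stays:
  assumes "T permutes {1..n}" "a \<in> {1..n}" "b \<in> {1..n}" "T b = Suc (T a)"
    and "vertex T \<circ> swap a b \<notin> A"
  shows "vertex (T \<circ> swap a b) = vertex T"
  using vertex_adjacent_swap[OF assms(1-4)] assms(5) by simp

lemma not_below_if_vertex_stays:
  assumes T: "T permutes {1..n}" and ab: "a \<in> {1..n}" "b \<in> {1..n}" "a < b" "T b = Suc (T a)"
    and stays: "vertex (T \<circ> swap a b) = vertex T"
  shows "vertex T \<circ> swap a b \<notin> A"
proof
  assume *: "vertex T \<circ> swap a b \<in> A"
  have less: "vertex T a < vertex T b" using vertex_noninversion[OF T ab(1-3)] ab by simp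
  then have "vertex T = vertex T \<circ> swap a b"
    using vertex_adjacent_swap[OF T ab(1,2,4)] stays * by simp
  then show False using less by (metis comp_apply less_irrefl swap_apply)
qed

lemma vertex_swap_cases:
  assumes "T permutes {1..n}" "a \<in> {1..n}" "b \<in> {1..n}" "T b = Suc (T a)"
  shows "vertex (T \<circ> swap a b) = vertex T \<or> vertex (T \<circ> swap a b) = vertex T \<circ> swap a b"
  using vertex_adjacent_swap[OF assms] by simp

lemma A_up_closed_complement:
  "V \<notin> A \<Longrightarrow> V permutes {1..n} \<Longrightarrow> (bruhat_step n)\<^sup>*\<^sup>* V X \<Longrightarrow> X \<notin> A"
  using A_down by blast

lemma fibre_coverI:
  "weak_cover n T (T \<circ> swap a b) \<Longrightarrow> vertex (T \<circ> swap a b) = vertex T \<Longrightarrow> fibre_cover T (T \<circ> swap a b)"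
  by (simp add: fibre_cover_def)

text \<open>
  The exchange of \<open>c\<close> and \<open>d\<close> leads upwards in Bruhat order, and the complement of the interval is closed
  upwards; so the exchange of \<open>a\<close> and \<open>b\<close> is still impossible after it.
\<close>
lemma fibre_cover_commutes_square:
  assumes T: "T permutes {1..n}" and ab: "a \<in> {1..n}" "b \<in> {1..n}" "a < b" "T b = Suc (T a)"
    and cd: "c \<in> {1..n}" "d \<in> {1..n}" "c < d" "T d = Suc (T c)" and disj: "{a, b} \<inter> {c, d} = {}"
    and stays: "vertex (T \<circ> swap a b) = vertex T"
  shows "fibre_cover (T \<circ> swap c d) (T \<circ> swap c d \<circ> swap a b)"
proof -
  define U where "U = vertex T"
  define Z where "Z = T \<circ> swap c d"
  have Z: "Z permutes {1..n}" unfolding Z_def by (rule permutes_swap_comp[OF T cd(1,2)])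
  have notA: "U \<circ> swap a b \<notin> A"
    unfolding U_def by (rule not_below_if_vertex_stays[OF T ab stays])
  have "U c < U d" unfolding U_def using vertex_noninversion[OF T cd(1-3)] cd(4) by simp
  then have "bruhat_step n (U \<circ> swap a b) (U \<circ> swap a b \<circ> swap c d)"
    using cd disj by (intro up_step_swap) (auto simp: swap_apply)
  moreover have "U \<circ> swap a b permutes {1..n}"
    unfolding U_def by (rule permutes_swap_comp[OF vertex_permutes[OF T] ab(1,2)])
  ultimately have "U \<circ> swap a b \<circ> swap c d \<notin> A"
    using A_up_closed_complement[OF notA] by blast
  moreover have "U \<circ> swap a b \<circ> swap c d = U \<circ> swap c d \<circ> swap a b"
    using disj by (auto simp: fun_eq_iff swap_apply)
  ultimately have "vertex Z \<circ> swap a b \<notin> A"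
    using vertex_swap_cases[OF T cd(1,2,4)] notA unfolding Z_def U_def by auto
  moreover have Zb: "Z b = Suc (Z a)" using ab disj by (auto simp: Z_def swap_apply)
  ultimately show ?thesis
    using vertex_stays[OF Z ab(1,2) Zb] weak_coverI[OF Z ab(1-3) Zb]
    unfolding Z_def[symmetric] by (intro fibre_coverI)
qed

text \<open>
  Let \<open>U\<close> be the vertex of \<open>T\<close>, in which \<open>p\<close>, \<open>q\<close>, \<open>r\<close> stand in this order. If \<open>U \<circ> swap p q\<close> is outside the
  interval, then so are all elements above it, and these include the results of both remaining
  exchanges on the opposite side of the hexagon, whether or not its first step has changed the vertex.
  The second claim is the mirror image.
\<close>
lemma fibre_cover_commutes_hexagon:
  assumes T: "T permutes {1..n}" and p: "p \<in> {1..n}" and r: "r \<in> {1..n}"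
    and lt: "p < q" "q < r" and adj: "T q = Suc (T p)" "T r = Suc (T q)"
  shows "vertex (T \<circ> swap p q) = vertex T \<Longrightarrow>
      fibre_cover (T \<circ> swap q r) (T \<circ> swap q r \<circ> swap p r) \<and>
      fibre_cover (T \<circ> swap q r \<circ> swap p r) (T \<circ> swap p r)"
    and "vertex (T \<circ> swap q r) = vertex T \<Longrightarrow>
      fibre_cover (T \<circ> swap p q) (T \<circ> swap p q \<circ> swap p r) \<and>
      fibre_cover (T \<circ> swap p q \<circ> swap p r) (T \<circ> swap p r)"
proof -
  have q: "q \<in> {1..n}" using lt p r by auto
  define U where "U = vertex T"
  have Up: "U permutes {1..n}" unfolding U_def by (rule vertex_permutes[OF T])
  have U: "U p < U q" "U q < U r"
    unfolding U_def using vertex_noninversion[OF T p q lt(1)] vertex_noninversion[OF T q r lt(2)] adj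
    by auto
  note hex = weak_hexagon[OF T p r lt adj]
  note between = bruhat_between[OF p r lt U]
  have loop1: "T \<circ> swap q r \<circ> swap p r \<circ> swap p q = T \<circ> swap p r"
    and loop2: "T \<circ> swap p q \<circ> swap p r \<circ> swap q r = T \<circ> swap p r"
    using lt by (auto simp: fun_eq_iff swap_apply)
  {
    assume stays: "vertex (T \<circ> swap p q) = vertex T"
    have notA: "U \<circ> swap p q \<notin> A"
      unfolding U_def by (rule not_below_if_vertex_stays[OF T p q lt(1) adj(1) stays])
    have X: "X \<notin> A" if "(bruhat_step n)\<^sup>*\<^sup>* (U \<circ> swap p q) X" for X
      using A_up_closed_complement[OF notA permutes_swap_comp[OF Up p q] that] .
    define Z where "Z = T \<circ> swap q r"
    define V where "V = vertex Z"
    have Z: "Z permutes {1..n}" unfolding Z_def by (rule permutes_swap_comp[OF T q r])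
    have Z': "Z \<circ> swap p r permutes {1..n}" by (rule permutes_swap_comp[OF Z p r])
    have "bruhat_step n (U \<circ> swap p q) (U \<circ> swap p q \<circ> swap q r)"
      "bruhat_step n (U \<circ> swap p q) (U \<circ> swap p q \<circ> swap p r)"
      by (rule up_step_swap; use p q r lt U in \<open>simp add: swap_apply\<close>)+
    moreover have "U \<circ> swap p q \<circ> swap q r = U \<circ> swap q r \<circ> swap p r"
      "U \<circ> swap p q \<circ> swap p r = U \<circ> swap q r \<circ> swap p q"
      using lt by (auto simp: fun_eq_iff swap_apply)
    ultimately have notA': "U \<circ> swap q r \<circ> swap p r \<notin> A" "U \<circ> swap q r \<circ> swap p q \<notin> A"
      using X by (metis r_into_rtranclp)+
    have "V = U \<or> V = U \<circ> swap q r"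
      using vertex_swap_cases[OF T q r adj(2)] by (simp add: V_def Z_def U_def)
    then have V: "V \<circ> swap p r \<notin> A" "V \<circ> swap p q \<notin> A"
      using notA notA' X[OF between(1)] by auto
    have 1: "vertex (Z \<circ> swap p r) = V"
      unfolding V_def by (rule vertex_stays[OF Z p r]) (use lt adj V in \<open>auto simp: Z_def V_def swap_apply\<close>)
    have 2: "vertex (Z \<circ> swap p r \<circ> swap p q) = vertex (Z \<circ> swap p r)"
      by (rule vertex_stays[OF Z' p q]) (use lt adj V 1 in \<open>auto simp: Z_def swap_apply\<close>)
    show "fibre_cover (T \<circ> swap q r) (T \<circ> swap q r \<circ> swap p r) \<and>
      fibre_cover (T \<circ> swap q r \<circ> swap p r) (T \<circ> swap p r)"
      using 1 2 hex(3,4) unfolding V_def Z_def loop1 fibre_cover_def by simp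
  next
    assume stays: "vertex (T \<circ> swap q r) = vertex T"
    have notA: "U \<circ> swap q r \<notin> A"
      unfolding U_def by (rule not_below_if_vertex_stays[OF T q r lt(2) adj(2) stays])
    have X: "X \<notin> A" if "(bruhat_step n)\<^sup>*\<^sup>* (U \<circ> swap q r) X" for X
      using A_up_closed_complement[OF notA permutes_swap_comp[OF Up q r] that] .
    define Z where "Z = T \<circ> swap p q"
    define V where "V = vertex Z"
    have Z: "Z permutes {1..n}" unfolding Z_def by (rule permutes_swap_comp[OF T p q])
    have Z': "Z \<circ> swap p r permutes {1..n}" by (rule permutes_swap_comp[OF Z p r])
    have "bruhat_step n (U \<circ> swap q r) (U \<circ> swap q r \<circ> swap p q)"
      "bruhat_step n (U \<circ> swap q r) (U \<circ> swap q r \<circ> swap p r)"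
      by (rule up_step_swap; use p q r lt U in \<open>simp add: swap_apply\<close>)+
    moreover have "U \<circ> swap q r \<circ> swap p q = U \<circ> swap p q \<circ> swap p r"
      "U \<circ> swap q r \<circ> swap p r = U \<circ> swap p q \<circ> swap q r"
      using lt by (auto simp: fun_eq_iff swap_apply)
    ultimately have notA': "U \<circ> swap p q \<circ> swap p r \<notin> A" "U \<circ> swap p q \<circ> swap q r \<notin> A"
      using X by (metis r_into_rtranclp)+
    have "V = U \<or> V = U \<circ> swap p q"
      using vertex_swap_cases[OF T p q adj(1)] by (simp add: V_def Z_def U_def)
    then have V: "V \<circ> swap p r \<notin> A" "V \<circ> swap q r \<notin> A"
      using notA notA' X[OF between(2)] by auto
    have 1: "vertex (Z \<circ> swap p r) = V"
      unfolding V_def by (rule vertex_stays[OF Z p r]) (use lt adj V in \<open>auto simp: Z_def V_def swap_apply\<close>)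
    have 2: "vertex (Z \<circ> swap p r \<circ> swap q r) = vertex (Z \<circ> swap p r)"
      by (rule vertex_stays[OF Z' q r]) (use lt adj V 1 in \<open>auto simp: Z_def swap_apply\<close>)
    show "fibre_cover (T \<circ> swap p q) (T \<circ> swap p q \<circ> swap p r) \<and>
      fibre_cover (T \<circ> swap p q \<circ> swap p r) (T \<circ> swap p r)"
      using 1 2 hex(1,2) unfolding V_def Z_def loop2 fibre_cover_def by simp
  }
qed

lemma fibre_cover_local_commutation:
  assumes "fibre_cover T Y" "weak_cover n T Z"
  shows "\<exists>t. (weak_cover n)\<^sup>*\<^sup>* Y t \<and> fibre_cover\<^sup>*\<^sup>* Z t"
proof -
  have Y: "weak_cover n T Y" "vertex Y = vertex T" using assms(1) by (simp_all add: fibre_cover_def)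
  have T: "T permutes {1..n}" using assms(2) by (simp add: weak_cover_def)
  show ?thesis
    using Y(1) assms(2)
  proof (cases rule: weak_cover_pair_cases)
    case equal
    then show ?thesis by blast
  next
    case (square a b c d)
    have "weak_cover n Y (T \<circ> swap c d \<circ> swap a b)"
      using weak_square[OF T square(1-9)] square(10) by simp
    moreover have "fibre_cover Z (T \<circ> swap c d \<circ> swap a b)"
      using fibre_cover_commutes_square[OF T square(1-9)] Y(2) square(10,11) by simp
    ultimately show ?thesis by blast
  next
    case (hexagon p q r)
    note hex = weak_hexagon[OF T hexagon(1,3-7)]
      and fib = fibre_cover_commutes_hexagon[OF T hexagon(1,3-7)]
    show ?thesis
      using hexagon(8)
    proof
      assume *: "Y = T \<circ> swap p q \<and> Z = T \<circ> swap q r"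
      then have "(weak_cover n)\<^sup>*\<^sup>* Y (T \<circ> swap p r)" "fibre_cover\<^sup>*\<^sup>* Z (T \<circ> swap p r)"
        using hex(1,2) fib(1) Y(2) by (meson rtranclp.rtrancl_into_rtrancl r_into_rtranclp)+
      then show ?thesis by blast
    next
      assume *: "Y = T \<circ> swap q r \<and> Z = T \<circ> swap p q"
      then have "(weak_cover n)\<^sup>*\<^sup>* Y (T \<circ> swap p r)" "fibre_cover\<^sup>*\<^sup>* Z (T \<circ> swap p r)"
        using hex(3,4) fib(2) Y(2) by (meson rtranclp.rtrancl_into_rtrancl r_into_rtranclp)+
      then show ?thesis by blast
    qed
  qed
qed

text \<open>
  Equality of vertices is compatible with joins in weak order: if \<open>T\<close> and \<open>Y\<close> share a vertex, \<open>Z\<close> can be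
  raised to an upper bound of \<open>Y\<close> and \<open>Z\<close> without changing its vertex.
\<close>
lemma fibre_covers_commutation:
  assumes "fibre_cover\<^sup>*\<^sup>* T Y" "(weak_cover n)\<^sup>*\<^sup>* T Z"
  shows "\<exists>t. (weak_cover n)\<^sup>*\<^sup>* Y t \<and> fibre_cover\<^sup>*\<^sup>* Z t"
  by (rule local_commutation_imp_commutation[where m = "\<lambda>T. n * n - card (inversions n T)",
        OF _ fibre_cover_local_commutation assms])
    (use weak_corank_decreases fibre_cover_def in blast)+

lemma fibre_covers_vertex: "fibre_cover\<^sup>*\<^sup>* T S \<Longrightarrow> vertex S = vertex T"
  by (induction rule: rtranclp_induct) (simp_all add: fibre_cover_def)

lemma fibre_covers_weak: "fibre_cover\<^sup>*\<^sup>* T S \<Longrightarrow> (weak_cover n)\<^sup>*\<^sup>* T S"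
  by (rule rtranclp_mono[THEN predicate2D]) (auto simp: fibre_cover_def)

lemma weak_cover_vertex:
  assumes "weak_cover n T S"
  shows "vertex_cover\<^sup>*\<^sup>* (vertex T) (vertex S)"
proof (cases "vertex T = vertex S")
  case False
  then have "vertex_cover (vertex T) (vertex S)" using assms unfolding vertex_cover_def by blast
  then show ?thesis by blast
qed simp

lemma weak_covers_vertex:
  "(weak_cover n)\<^sup>*\<^sup>* T S \<Longrightarrow> vertex_cover\<^sup>*\<^sup>* (vertex T) (vertex S)"
proof (induction rule: rtranclp_induct)
  case (step S R)
  then show ?case using weak_cover_vertex rtranclp_trans by metis
qed simp

lemma vertex_cover_bruhat:
  assumes "vertex_cover U V"
  shows "bruhat_step n U V"
proof -
  obtain T S where "weak_cover n T S" and UV: "vertex T = U" "vertex S = V" "U \<noteq> V"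
    using assms unfolding vertex_cover_def by blast
  then obtain a b where T: "T permutes {1..n}" and ab: "a \<in> {1..n}" "b \<in> {1..n}" "a < b"
    "T b = Suc (T a)" "S = T \<circ> swap a b" unfolding weak_cover_def by blast
  have "V = (if U a < U b \<and> U \<circ> swap a b \<in> A then U \<circ> swap a b else U)"
    using vertex_adjacent_swap[OF T ab(1,2,4)] unfolding ab(5)[symmetric] UV(1,2) .
  then have "U a < U b \<and> V = U \<circ> swap a b" using UV(3) by argo
  then show ?thesis using ab up_step_swap[of "\<lambda>a. a" a b U n] by simp
qed

lemma vertex_covers_bruhat: "vertex_cover\<^sup>*\<^sup>* U V \<Longrightarrow> (bruhat_step n)\<^sup>*\<^sup>* U V"
  by (rule rtranclp_mono[THEN predicate2D]) (auto intro: vertex_cover_bruhat)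

lemma vertex_covers_antisym: "vertex_cover\<^sup>*\<^sup>* U V \<Longrightarrow> vertex_cover\<^sup>*\<^sup>* V U \<Longrightarrow> U = V"
  using vertex_covers_bruhat up_steps_antisym by metis

text \<open>
  Vertices only go up along weak order, so between equal ends they are constant.
\<close>
lemma fibre_convex:
  assumes "(weak_cover n)\<^sup>*\<^sup>* T S" "vertex T = vertex S"
  shows "fibre_cover\<^sup>*\<^sup>* T S"
  using assms
proof (induction rule: converse_rtranclp_induct)
  case (step T R)
  have "vertex_cover\<^sup>*\<^sup>* (vertex T) (vertex R)" "vertex_cover\<^sup>*\<^sup>* (vertex R) (vertex S)"
    using step.hyps weak_cover_vertex weak_covers_vertex by blast+
  then have "vertex R = vertex T" using step.prems vertex_covers_antisym by metis
  then have "fibre_cover T R" using step.hyps(1) by (simp add: fibre_cover_def)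
  moreover have "fibre_cover\<^sup>*\<^sup>* R S"
    using step.IH step.prems \<open>vertex R = vertex T\<close> by simp
  ultimately show ?case by (rule converse_rtranclp_into_rtranclp)
qed simp

lemma fibre_covers_from_vertex:
  assumes T: "T permutes {1..n}"
  shows "fibre_cover\<^sup>*\<^sup>* (vertex T) T"
  using weak_covers_if_inversions_subset[OF vertex_permutes[OF T] T inversions_vertex_subset[OF T]]
    vertex_self[OF vertex_least(1)[OF T]] by (intro fibre_convex)

text \<open>
  Every ranking in the fibre of \<open>U\<close> lies above \<open>U\<close> itself, so by commutation any two of them have an
  upper bound in the fibre.
\<close>
lemma fibre_has_top:
  assumes "U \<in> A"
  shows "\<exists>m. m permutes {1..n} \<and> vertex m = U \<and>
    (\<forall>T. T permutes {1..n} \<and> vertex T = U \<longrightarrow> inversions n T \<subseteq> inversions n m)"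
proof -
  let ?F = "{T. T permutes {1..n} \<and> vertex T = U}"
  have "\<exists>t\<in>?F. inversions n T \<subseteq> inversions n t \<and> inversions n S \<subseteq> inversions n t"
    if "T \<in> ?F" "S \<in> ?F" for T S
  proof -
    have TS: "fibre_cover\<^sup>*\<^sup>* U T" "fibre_cover\<^sup>*\<^sup>* U S" "S permutes {1..n}" "vertex S = U"
      using that fibre_covers_from_vertex[of T] fibre_covers_from_vertex[of S] by simp_all
    then obtain t where t: "(weak_cover n)\<^sup>*\<^sup>* T t" "fibre_cover\<^sup>*\<^sup>* S t"
      using fibre_covers_commutation[OF TS(1) fibre_covers_weak[OF TS(2)]] by blast
    have "t permutes {1..n}" "vertex t = U"
      using weak_covers_permutes[OF fibre_covers_weak[OF t(2)] TS(3)] fibre_covers_vertex[OF t(2)] TS(4)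
      by simp_all
    then show ?thesis
      using weak_covers_inversions[OF t(1)] weak_covers_inversions[OF fibre_covers_weak[OF t(2)]]
      by blast
  qed
  moreover have "finite ?F"
    by (rule finite_subset[OF _ finite_permutations[of "{1..n}"]]) auto
  moreover have "U \<in> ?F" using assms A_permutes vertex_self by blast
  ultimately show ?thesis using directed_has_greatest[of ?F "inversions n"] by blast
qed

definition fibre_top :: "(nat \<Rightarrow> nat) \<Rightarrow> nat \<Rightarrow> nat" where
  "fibre_top U = (SOME m. m permutes {1..n} \<and> vertex m = U \<and>
    (\<forall>T. T permutes {1..n} \<and> vertex T = U \<longrightarrow> inversions n T \<subseteq> inversions n m))"

lemma fibre_top:
  assumes "U \<in> A"
  shows "fibre_top U permutes {1..n}" "vertex (fibre_top U) = U"
    and "T permutes {1..n} \<Longrightarrow> vertex T = U \<Longrightarrow> inversions n T \<subseteq> inversions n (fibre_top U)"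
  using someI_ex[OF fibre_has_top[OF assms]] unfolding fibre_top_def[symmetric] by blast+

lemma vertex_cover_A: "vertex_cover U V \<Longrightarrow> U \<in> A \<and> V \<in> A"
  unfolding vertex_cover_def using vertex_least(1) weak_cover_permutes weak_cover_def by metis

text \<open>
  Let \<open>T\<close> be covered by \<open>S\<close> where the vertex changes from \<open>U\<close> to \<open>V\<close>. The way from \<open>T\<close> up to the top of
  the fibre of \<open>U\<close> commutes with this cover, so the top lies below some ranking in the fibre of \<open>V\<close>.
\<close>
lemma fibre_top_mono_cover:
  assumes "vertex_cover U V"
  shows "inversions n (fibre_top U) \<subseteq> inversions n (fibre_top V)"
proof -
  obtain T S where TS: "weak_cover n T S" "vertex T = U" "vertex S = V"
    using assms unfolding vertex_cover_def by blast
  have T: "T permutes {1..n}" and S: "S permutes {1..n}"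
    using TS(1) weak_cover_permutes by (auto simp: weak_cover_def)
  have U: "U \<in> A" and V: "V \<in> A" using vertex_cover_A[OF assms] by auto
  note top = fibre_top[OF U]
  have "fibre_cover\<^sup>*\<^sup>* T (fibre_top U)"
    using weak_covers_if_inversions_subset[OF T top(1) top(3)[OF T TS(2)]] TS(2) top(2)
    by (intro fibre_convex) simp_all
  then obtain t where t: "(weak_cover n)\<^sup>*\<^sup>* (fibre_top U) t" "fibre_cover\<^sup>*\<^sup>* S t"
    using fibre_covers_commutation TS(1) by blast
  have "t permutes {1..n}" "vertex t = V"
    using weak_covers_permutes[OF t(1) top(1)] fibre_covers_vertex[OF t(2)] TS(3) by simp_all
  then have "inversions n t \<subseteq> inversions n (fibre_top V)" by (rule fibre_top(3)[OF V])
  then show ?thesis using weak_covers_inversions[OF t(1)] by blast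
qed

lemma fibre_top_mono:
  "vertex_cover\<^sup>*\<^sup>* U V \<Longrightarrow> inversions n (fibre_top U) \<subseteq> inversions n (fibre_top V)"
  by (induction rule: rtranclp_induct) (use fibre_top_mono_cover in blast)+

text \<open>
  A Galois connection between weak order and the order generated by the edges: \<open>vertex\<close> is the lower
  adjoint of \<open>fibre_top\<close>.
\<close>
lemma vertex_le_iff:
  assumes T: "T permutes {1..n}" and V: "V \<in> A"
  shows "vertex_cover\<^sup>*\<^sup>* (vertex T) V \<longleftrightarrow> inversions n T \<subseteq> inversions n (fibre_top V)"
proof
  assume "vertex_cover\<^sup>*\<^sup>* (vertex T) V"
  then show "inversions n T \<subseteq> inversions n (fibre_top V)"
    using fibre_top_mono fibre_top(3)[OF vertex_least(1)[OF T] T] by blast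
next
  assume "inversions n T \<subseteq> inversions n (fibre_top V)"
  then have "(weak_cover n)\<^sup>*\<^sup>* T (fibre_top V)"
    using weak_covers_if_inversions_subset[OF T fibre_top(1)[OF V]] by blast
  then show "vertex_cover\<^sup>*\<^sup>* (vertex T) V"
    using weak_covers_vertex fibre_top(2)[OF V] by metis
qed

text \<open>
  By the Galois connection, the vertices below all of \<open>Z\<close> come from the rankings below all the tops
  of their fibres, and these rankings have a greatest element \<open>M\<close>.
\<close>
lemma vertex_meet_exists:
  assumes "Z \<subseteq> A"
  shows "\<exists>m\<in>A. (\<forall>V\<in>Z. vertex_cover\<^sup>*\<^sup>* m V) \<and>
    (\<forall>U\<in>A. (\<forall>V\<in>Z. vertex_cover\<^sup>*\<^sup>* U V) \<longrightarrow> vertex_cover\<^sup>*\<^sup>* U m)"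
proof -
  obtain M where M: "M permutes {1..n}" "\<forall>S\<in>fibre_top ` Z. inversions n M \<subseteq> inversions n S"
    and max: "\<forall>T. T permutes {1..n} \<and> (\<forall>S\<in>fibre_top ` Z. inversions n T \<subseteq> inversions n S) \<longrightarrow>
      inversions n T \<subseteq> inversions n M"
    using weak_meet_exists[of n "fibre_top ` Z"] by (elim exE conjE)
  have "vertex_cover\<^sup>*\<^sup>* (vertex M) V" if "V \<in> Z" for V
    using that assms vertex_le_iff[OF M(1), of V] M(2) by auto
  moreover have "vertex_cover\<^sup>*\<^sup>* U (vertex M)" if U: "U \<in> A" and le: "\<forall>V\<in>Z. vertex_cover\<^sup>*\<^sup>* U V" for U
  proof -
    have "inversions n U \<subseteq> inversions n (fibre_top V)" if "V \<in> Z" for V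
      using vertex_le_iff[OF A_permutes[OF U], of V] vertex_self[OF U] le that assms by auto
    then have "inversions n U \<subseteq> inversions n M" using max A_permutes[OF U] by simp
    then show ?thesis
      using weak_covers_vertex[OF weak_covers_if_inversions_subset[OF A_permutes[OF U] M(1)]]
        vertex_self[OF U] by simp
  qed
  ultimately show ?thesis using vertex_least(1)[OF M(1)] by blast
qed
end

section \<open>Edges of the polytope\<close>

text \<open>
  The rank of \<open>x\<close> counts the elements up to \<open>x\<close> in the lexicographic order by \<open>f\<close> and then by \<open>U\<close>.
\<close>
lemma lexicographic_ranking_exists:
  fixes f :: "nat \<Rightarrow> real"
  assumes U: "U permutes {1..n}"
  shows "\<exists>T. T permutes {1..n} \<and> (\<forall>x\<in>{1..n}. \<forall>y\<in>{1..n}.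
    T x < T y \<longleftrightarrow> f x < f y \<or> f x = f y \<and> U x < U y)"
proof -
  define L where "L x y \<longleftrightarrow> f x < f y \<or> f x = f y \<and> U x < U y" for x y
  define T where "T x = (if x \<in> {1..n} then card {y \<in> {1..n}. y = x \<or> L y x} else x)" for x
  have trans: "L x y \<Longrightarrow> L y z \<Longrightarrow> L x z" for x y z by (auto simp: L_def)
  have irrefl: "\<not> L x x" for x by (simp add: L_def)
  have total: "L x y \<or> L y x" if "x \<noteq> y" for x y
    using permutes_neq[OF U that] by (auto simp: L_def)
  have mono: "T x < T y" if "x \<in> {1..n}" "y \<in> {1..n}" "L x y" for x y
  proof -
    have "y \<notin> {z \<in> {1..n}. z = x \<or> L z x}" using that(3) trans irrefl by blast
    then have "{z \<in> {1..n}. z = x \<or> L z x} \<subset> {z \<in> {1..n}. z = y \<or> L z y}"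
      using that trans by blast
    then show ?thesis using that by (simp add: T_def psubset_card_mono)
  qed
  have iff: "T x < T y \<longleftrightarrow> L x y" if "x \<in> {1..n}" "y \<in> {1..n}" for x y
    using mono[OF that] mono[OF that(2,1)] total[of x y] by (metis less_asym less_irrefl)
  have "T x \<in> {1..n}" if "x \<in> {1..n}" for x
  proof -
    have "card {x} \<le> T x" unfolding T_def using that by (simp only: if_True) (intro card_mono, auto)
    moreover have "T x \<le> card {1..n}" unfolding T_def using that by (simp only: if_True) (intro card_mono, auto)
    ultimately show ?thesis by simp
  qed
  moreover have "inj_on T {1..n}"
    using mono total by (intro inj_onI) (metis less_irrefl)
  ultimately have "bij_betw T {1..n} {1..n}"
    by (metis bij_betw_def endo_inj_surj finite_atLeastAtMost image_subsetI)
  then have "T permutes {1..n}" by (rule bij_imp_permutes) (auto simp: T_def)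
  then show ?thesis using iff unfolding L_def by blast
qed

text \<open>
  The functional \<open>f\<close> lies in the closed chamber of \<open>T\<close>.
\<close>
definition refines :: "nat \<Rightarrow> (nat \<Rightarrow> nat) \<Rightarrow> (nat \<Rightarrow> real) \<Rightarrow> bool" where
  "refines n T f \<longleftrightarrow> T permutes {1..n} \<and> (\<forall>x\<in>{1..n}. \<forall>y\<in>{1..n}. T x < T y \<longrightarrow> f x \<le> f y)"

context bruhat_ideal
begin

text \<open>
  The chambers whose closure contains \<open>f\<close> are connected through walls, since neighbours on which \<open>T\<close> and
  \<open>S\<close> disagree have equal coefficients. On a walk from a chamber of \<open>U\<close> to one of \<open>V\<close> the vertex must
  jump somewhere.
\<close>
lemma vertex_changes_along_walk:
  fixes f :: "nat \<Rightarrow> real"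
  assumes two: "\<And>T. refines n T f \<Longrightarrow> vertex T = U \<or> vertex T = V"
    and "U \<noteq> V" "refines n T f" "refines n S f" "vertex T = U" "vertex S = V"
  shows "\<exists>R. \<exists>a\<in>{1..n}. \<exists>b\<in>{1..n}. R permutes {1..n} \<and> R b = Suc (R a) \<and>
    vertex R = U \<and> vertex (R \<circ> swap a b) = V"
  using assms(3-6)
proof (induction "card {(x, y) \<in> {1..n} \<times> {1..n}. T x < T y \<and> S y < S x}" arbitrary: T rule: less_induct)
  case less
  let ?D = "\<lambda>T. {(x, y) \<in> {1..n} \<times> {1..n}. T x < T y \<and> S y < S x}"
  have T: "T permutes {1..n}" and Tf: "\<And>x y. x \<in> {1..n} \<Longrightarrow> y \<in> {1..n} \<Longrightarrow> T x < T y \<Longrightarrow> f x \<le> f y"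
    using less.prems(1) unfolding refines_def by blast+
  have S: "S permutes {1..n}" and Sf: "\<And>x y. x \<in> {1..n} \<Longrightarrow> y \<in> {1..n} \<Longrightarrow> S x < S y \<Longrightarrow> f x \<le> f y"
    using less.prems(2) unfolding refines_def by blast+
  have "T \<noteq> S" using less.prems \<open>U \<noteq> V\<close> by blast
  then obtain a b where ab: "a \<in> {1..n}" "b \<in> {1..n}" "T b = Suc (T a)" "S b < S a"
    using adjacent_disagreement[OF T S] by blast
  let ?T = "T \<circ> swap a b"
  have T': "?T permutes {1..n}" by (rule permutes_swap_comp[OF T ab(1,2)])
  have "f b \<le> f a" using Sf ab by blast
  then have refines': "refines n ?T f"
    unfolding refines_def using T' Tf adjacent_swap_order[OF T ab(3)] by blast
  show ?case
  proof (cases "vertex ?T = V")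
    case True
    then show ?thesis using T ab less.prems(3) by blast
  next
    case False
    then have U: "vertex ?T = U" using two[OF refines'] by blast
    have "?D ?T \<subseteq> ?D T"
      using adjacent_swap_order[OF T ab(3)] ab(4) by fastforce
    moreover have "(a, b) \<in> ?D T" "(a, b) \<notin> ?D ?T" using ab by (auto simp: swap_apply)
    ultimately have "?D ?T \<subset> ?D T" by blast
    moreover have "finite (?D T)" by (rule finite_subset[of _ "{1..n} \<times> {1..n}"]) auto
    ultimately have "card (?D ?T) < card (?D T)" by (rule psubset_card_mono[rotated])
    from less.hyps[OF this refines' less.prems(2) U less.prems(4)] show ?thesis .
  qed
qed
end

locale bruhat_polytope = bruhat_ideal n W for n W +
  fixes c :: "'n::finite \<Rightarrow> nat"
  assumes c: "bij_betw c UNIV {1..n}"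
begin

definition pt :: "(nat \<Rightarrow> nat) \<Rightarrow> real ^ 'n" where
  "pt U = (\<chi> i. real (U (c i)))"

definition functional :: "(nat \<Rightarrow> real) \<Rightarrow> real ^ 'n" where
  "functional f = (\<chi> i. f (c i))"

lemma functional_inner: "functional f \<bullet> pt U = pairing n f U"
proof -
  have "functional f \<bullet> pt U = (\<Sum>i\<in>UNIV. f (c i) * real (U (c i)))"
    by (simp add: functional_def pt_def inner_vec_def)
  also have "\<dots> = (\<Sum>k\<in>{1..n}. f k * real (U k))"
    by (rule sum.reindex_bij_betw[OF c])
  finally show ?thesis by (simp add: pairing_def)
qed

lemma functional_surj: "\<exists>f. a = functional f"
proof
  show "a = functional (\<lambda>k. a $ inv c k)"
    using c by (simp add: functional_def vec_eq_iff bij_betw_def inv_f_f)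
qed

lemma pt_inj:
  assumes "pt U = pt V" "U permutes {1..n}" "V permutes {1..n}"
  shows "U = V"
proof
  fix k
  show "U k = V k"
  proof (cases "k \<in> {1..n}")
    case True
    then obtain i where "k = c i" using bij_betw_imp_surj_on[OF c] by blast
    then show ?thesis using assms(1) by (simp add: pt_def vec_eq_iff)
  qed (metis assms(2,3) permutes_not_in)
qed

abbreviation Q :: "(real ^ 'n) set" where
  "Q \<equiv> convex hull (pt ` A)"

text \<open>
  The functional on the wall that is crossed has its maximum at \<open>U\<close> and \<open>V\<close> and at no other vertex.
\<close>
lemma vertex_cover_imp_edge:
  assumes "vertex_cover U V"
  shows "closed_segment (pt U) (pt V) edge_of Q"
proof -
  obtain T S where TS: "weak_cover n T S" "vertex T = U" "vertex S = V" and ne: "U \<noteq> V"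
    using assms unfolding vertex_cover_def by blast
  then obtain a b where T: "T permutes {1..n}" and ab: "a \<in> {1..n}" "b \<in> {1..n}" "a < b"
    "T b = Suc (T a)" "S = T \<circ> swap a b" unfolding weak_cover_def by blast
  have UV: "U \<in> A" "V \<in> A" using vertex_cover_A[OF assms] by auto
  define f where "f = merged T a b"
  define m where "m = pairing n f U"
  have f: "f x \<le> f y" if "T x < T y" for x y unfolding f_def using merged_mono[of T b a, OF ab(4) that] .
  note steps = vertex_least(2)[OF T, unfolded TS(2)]
  have le: "pairing n f Y \<le> m" if "Y \<in> A" for Y
    unfolding m_def by (rule pairing_up_steps[OF steps[OF that] f])
  have V_eq: "V = U \<circ> swap a b"
    using vertex_swap_cases[OF T ab(1,2,4)] TS ne ab(5) by auto
  have eq: "Y = U \<or> Y = V" if "Y \<in> A" "pairing n f Y = m" for Y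
    using up_steps_within_wall[OF T ab(4) steps[OF that(1)]] that(2) V_eq
    unfolding f_def m_def by auto
  have V_m: "pairing n f V = m"
    using ab unfolding V_eq m_def by (simp add: pairing_swap f_def merged_def)
  let ?F = "Q \<inter> {x. functional f \<bullet> x = m}"
  have "Q \<subseteq> {x. functional f \<bullet> x \<le> m}"
    by (rule hull_minimal) (auto simp: functional_inner le convex_halfspace_le)
  then have face: "?F face_of Q"
    by (intro face_of_Int_supporting_hyperplane_le convex_convex_hull) auto
  obtain B where B: "B \<subseteq> pt ` A" "?F = convex hull B"
    using face_of_convex_hull_subset[OF _ face] finite_imp_compact[OF finite_imageI[OF finite_A]]
    by metis
  have "B \<subseteq> {pt U, pt V}"
  proof
    fix x assume "x \<in> B"
    then have "x \<in> ?F" unfolding B(2) by (rule hull_inc)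
    moreover obtain Y where Y: "Y \<in> A" "x = pt Y" using B(1) \<open>x \<in> B\<close> by blast
    ultimately have "pairing n f Y = m" by (simp add: functional_inner)
    then show "x \<in> {pt U, pt V}" using eq[OF Y(1)] Y(2) by blast
  qed
  then have "?F \<subseteq> closed_segment (pt U) (pt V)"
    unfolding B(2) segment_convex_hull by (rule hull_mono)
  moreover have "closed_segment (pt U) (pt V) \<subseteq> ?F"
  proof -
    have "pt U \<in> ?F" "pt V \<in> ?F"
      using UV V_m by (auto simp: functional_inner m_def intro: hull_inc)
    moreover have "convex ?F" using face face_of_imp_convex by blast
    ultimately show ?thesis by (simp add: convex_contains_segment)
  qed
  ultimately have "closed_segment (pt U) (pt V) face_of Q" using face by (metis subset_antisym)
  moreover have "pt U \<noteq> pt V" using pt_inj A_permutes UV ne by blast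
  then have "aff_dim (closed_segment (pt U) (pt V)) = 1"
    by (simp add: segment_convex_hull aff_dim_convex_hull aff_dim_2)
  ultimately show ?thesis by (simp add: edge_of_def)
qed

text \<open>
  An edge is the face of some functional \<open>f\<close>. Each chamber whose closure contains \<open>f\<close> has an end of
  the edge as its vertex, and both ends occur because ties of \<open>f\<close> can be broken in favour of either.
  So there is a wall at which the vertex jumps from \<open>U\<close> to \<open>V\<close>, and the lengths tell that it is crossed
  upwards in weak order.
\<close>
lemma edge_imp_vertex_cover:
  assumes U: "U \<in> A" and V: "V \<in> A"
    and edge: "closed_segment (pt U) (pt V) edge_of Q"
    and card: "card (inversions n U) < card (inversions n V)"
  shows "vertex_cover U V"
proof -
  have ne: "U \<noteq> V" using card by auto
  have face: "closed_segment (pt U) (pt V) face_of Q" using edge by (simp add: edge_of_def)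
  have "polyhedron Q"
    by (intro polytope_imp_polyhedron polytope_convex_hull finite_imageI finite_A)
  then have "closed_segment (pt U) (pt V) exposed_face_of Q"
    using face exposed_face_of_polyhedron by blast
  then obtain a m where Q_le: "Q \<subseteq> {x. a \<bullet> x \<le> m}"
    and F: "closed_segment (pt U) (pt V) = Q \<inter> {x. a \<bullet> x = m}"
    unfolding exposed_face_of_def by blast
  obtain f where a: "a = functional f" using functional_surj by blast
  have le: "pairing n f Y \<le> m" if "Y \<in> A" for Y
    using Q_le hull_inc[of "pt Y" "pt ` A"] that unfolding a functional_inner[symmetric] by blast
  have eq_m: "pairing n f U = m" "pairing n f V = m"
    using F ends_in_segment unfolding a functional_inner[symmetric] by blast+
  have only: "Y = U \<or> Y = V" if Y: "Y \<in> A" and max: "m \<le> pairing n f Y" for Y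
  proof (rule ccontr)
    assume not: "\<not> ?thesis"
    have "pt Y \<in> closed_segment (pt U) (pt V)"
      unfolding F using Y le[OF Y] max by (auto simp: a functional_inner intro: hull_inc)
    then obtain t where t: "0 \<le> t" "t \<le> 1" "pt Y = (1 - t) *\<^sub>R pt U + t *\<^sub>R pt V"
      unfolding closed_segment_def by blast
    \<comment> \<open>The functional of \<open>Y\<close> is smaller at \<open>U\<close> and \<open>V\<close>, hence on the whole segment.\<close>
    define N where "N X = functional (\<lambda>a. real (Y a)) \<bullet> pt X" for X
    have "N U < N Y" "N V < N Y"
      using not pairing_self_less[OF A_permutes[OF Y]] A_permutes U V
      unfolding N_def functional_inner by blast+
    then have "(1 - t) * N U + t * N V < N Y"
      using t by (intro convex_bound_lt) auto
    moreover have "N Y = (1 - t) * N U + t * N V"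
      unfolding N_def by (subst t(3)) (simp add: inner_add_right)
    ultimately show False by simp
  qed
  have two: "vertex T = U \<or> vertex T = V" if "refines n T f" for T
  proof -
    have T: "T permutes {1..n}" using that by (simp add: refines_def)
    have "pairing n f U \<le> pairing n f (vertex T)"
      using that by (intro pairing_up_steps[OF vertex_least(2)[OF T U]]) (auto simp: refines_def)
    then show ?thesis using only[OF vertex_least(1)[OF T]] eq_m by simp
  qed
  have hit: "\<exists>T. refines n T f \<and> vertex T = X" if X: "X \<in> A" "pairing n f X = m" for X
  proof -
    obtain T where T: "T permutes {1..n}"
      and lex: "\<And>x y. x \<in> {1..n} \<Longrightarrow> y \<in> {1..n} \<Longrightarrow> T x < T y \<longleftrightarrow> f x < f y \<or> f x = f y \<and> X x < X y"
      using lexicographic_ranking_exists[OF A_permutes[OF X(1)], of f] by blast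
    have "vertex T = X"
    proof (rule vertex_eqI[OF T X(1)])
      show "pairing n f (vertex T) \<le> pairing n f X" using le[OF vertex_least(1)[OF T]] X(2) by simp
    qed (use lex in auto)
    moreover have "refines n T f" unfolding refines_def using T lex by force
    ultimately show ?thesis by blast
  qed
  obtain TU TV where "refines n TU f" "vertex TU = U" "refines n TV f" "vertex TV = V"
    using hit[OF U eq_m(1)] hit[OF V eq_m(2)] by blast
  then obtain R a b where ab: "a \<in> {1..n}" "b \<in> {1..n}" and R: "R permutes {1..n}" "R b = Suc (R a)"
    "vertex R = U" "vertex (R \<circ> swap a b) = V"
    using vertex_changes_along_walk[OF two ne] by blast
  show ?thesis
  proof (cases "a < b")
    case True
    then show ?thesis
      unfolding vertex_cover_def using weak_coverI[OF R(1) ab True R(2)] R(3,4) ne by blast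
  next
    case False
    have "a \<noteq> b" using R(2) by auto
    then have "b < a" using False by simp
    then have "weak_cover n (R \<circ> swap a b) (R \<circ> swap a b \<circ> swap b a)"
      using R(2) ab by (intro weak_coverI permutes_swap_comp[OF R(1)]) (auto simp: swap_apply)
    then have "weak_cover n (R \<circ> swap a b) R" by (simp add: Transposition.transpose_commute[of b a])
    then have "vertex_cover V U" unfolding vertex_cover_def using R(3,4) ne[symmetric] by blast
    then have "card (inversions n V) < card (inversions n U)"
      using up_step_card_less[OF vertex_cover_bruhat A_permutes[OF V]] by blast
    then show ?thesis using card by simp
  qed
qed

lemma edge_iff_vertex_cover:
  assumes "U \<in> A" "V \<in> A"
  shows "closed_segment (pt U) (pt V) edge_of Q \<and> card (inversions n U) < card (inversions n V) \<longleftrightarrow>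
    vertex_cover U V"
  using vertex_cover_imp_edge edge_imp_vertex_cover[OF assms]
    up_step_card_less[OF vertex_cover_bruhat A_permutes[OF assms(1)]] by blast
end

section \<open>The lattice\<close>

text \<open>
  A join is the meet of all upper bounds.
\<close>
lemma lattice_if_meets_exist:
  fixes S :: "'a set" and r :: "'a \<Rightarrow> 'a \<Rightarrow> bool"
  assumes refl: "\<And>x. x \<in> S \<Longrightarrow> r x x"
    and antisym: "\<And>x y. x \<in> S \<Longrightarrow> y \<in> S \<Longrightarrow> r x y \<Longrightarrow> r y x \<Longrightarrow> x = y"
    and trans: "\<And>x y z. x \<in> S \<Longrightarrow> y \<in> S \<Longrightarrow> z \<in> S \<Longrightarrow> r x y \<Longrightarrow> r y z \<Longrightarrow> r x z"
    and meet: "\<And>Z. Z \<subseteq> S \<Longrightarrow> \<exists>m\<in>S. (\<forall>z\<in>Z. r m z) \<and> (\<forall>x\<in>S. (\<forall>z\<in>Z. r x z) \<longrightarrow> r x m)"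
  shows "lattice \<lparr>carrier = S, eq = (=), le = r\<rparr>"
proof -
  let ?L = "\<lparr>carrier = S, eq = (=), le = r\<rparr>"
  interpret partial_order ?L
    by unfold_locales (simp_all add: refl, (metis antisym trans)+)
  show ?thesis
  proof unfold_locales
    fix x y assume "x \<in> carrier ?L" "y \<in> carrier ?L"
    then have xy: "x \<in> S" "y \<in> S" by simp_all
    obtain m where "m \<in> S" "\<forall>z\<in>{x, y}. r m z" "\<forall>u\<in>S. (\<forall>z\<in>{x, y}. r u z) \<longrightarrow> r u m"
      using meet[of "{x, y}"] xy by auto
    then have "greatest ?L m (Lower ?L {x, y})"
      using xy by (auto simp: greatest_def Lower_def)
    then show "\<exists>m. greatest ?L m (Lower ?L {x, y})" by blast
    let ?B = "{z \<in> S. r x z \<and> r y z}"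
    obtain j where "j \<in> S" "\<forall>z\<in>?B. r j z" "\<forall>u\<in>S. (\<forall>z\<in>?B. r u z) \<longrightarrow> r u j"
      using meet[of ?B] by auto
    then have "least ?L j (Upper ?L {x, y})"
      using xy by (auto simp: least_def Upper_def)
    then show "\<exists>j. least ?L j (Upper ?L {x, y})" by blast
  qed
qed

lemma (in bruhat_polytope) skeleton_cover_iff:
  assumes u: "u permutes {1..n}" and v: "v permutes {1..n}"
  shows "skeleton_cover n c (inv W) u v \<longleftrightarrow> vertex_cover (inv u) (inv v)"
proof -
  have lower: "x \<in> lower_interval n (inv W) \<longleftrightarrow> inv x \<in> A" if "x permutes {1..n}" for x
    using that W bruhat_le_iff_up_steps[OF that permutes_inv[OF W]]
    by (simp add: lower_interval_def below_def permutes_inv permutes_inv_inv)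
  have point: "perm_point c x = pt (inv x)" for x
    by (simp add: perm_point_def pt_def)
  have "inv ` lower_interval n (inv W) = A"
  proof (intro equalityI subsetI)
    fix U assume U: "U \<in> A"
    then have "inv U \<in> lower_interval n (inv W)" "U = inv (inv U)"
      using lower[of "inv U"] A_permutes[OF U] by (simp_all add: permutes_inv permutes_inv_inv)
    then show "U \<in> inv ` lower_interval n (inv W)" by blast
  qed (use lower in \<open>auto simp: lower_interval_def\<close>)
  then have "perm_point c ` lower_interval n (inv W) = pt ` A"
    unfolding point[abs_def] by (metis image_image)
  then have "skeleton_cover n c (inv W) u v \<longleftrightarrow> inv u \<in> A \<and> inv v \<in> A \<and>
      closed_segment (pt (inv u)) (pt (inv v)) edge_of Q \<and>
      card (inversions n (inv u)) < card (inversions n (inv v))"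
    using lower[OF u] lower[OF v] coxeter_length_eq[OF u] coxeter_length_eq[OF v]
    by (simp add: skeleton_cover_def bruhat_interval_polytope_def point)
  then show ?thesis using edge_iff_vertex_cover vertex_cover_A by blast
qed

theorem theorem1:
  fixes n :: nat and c :: "'n::finite \<Rightarrow> nat" and w :: "nat \<Rightarrow> nat"
  assumes "bij_betw c UNIV {1..n}"
    and "w permutes {1..n}"
  shows "lattice (skeleton_poset n c w)"
proof -
  interpret bruhat_polytope n "inv w" c
    by unfold_locales (use assms in \<open>simp_all add: permutes_inv\<close>)
  let ?S = "lower_interval n w"
  have w: "inv (inv w) = w" using assms(2) by (simp add: permutes_inv_inv)
  have S: "u permutes {1..n}" "inv u \<in> A" if "u \<in> ?S" for u
    using that assms(2) bruhat_le_iff_up_steps[of u n w]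
    by (simp_all add: lower_interval_def below_def permutes_inv)
  have S': "inv U \<in> ?S" "inv (inv U) = U" if "U \<in> A" for U
    using that A_permutes[OF that] assms(2) bruhat_le_iff_up_steps[of "inv U" n w]
      permutes_inv_inv[OF A_permutes[OF that]]
    by (simp_all add: lower_interval_def below_def permutes_inv)
  have to_vertex: "vertex_cover\<^sup>*\<^sup>* (inv u) (inv v)" if "(skeleton_cover n c w)\<^sup>*\<^sup>* u v" for u v
    using that
  proof (induction)
    case (step x y)
    then have "x permutes {1..n}" "y permutes {1..n}"
      by (simp_all add: skeleton_cover_def lower_interval_def)
    then have "vertex_cover (inv x) (inv y)" using step.hyps(2) skeleton_cover_iff[of x y] w by simp
    then show ?case using step.IH by (meson rtranclp.rtrancl_into_rtrancl)
  qed simp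
  have from_vertex: "(skeleton_cover n c w)\<^sup>*\<^sup>* (inv U) (inv V)" if "vertex_cover\<^sup>*\<^sup>* U V" for U V
    using that
  proof (induction)
    case (step X Y)
    have XY: "X \<in> A" "Y \<in> A" using vertex_cover_A[OF step.hyps(2)] by auto
    then have "skeleton_cover n c w (inv X) (inv Y)"
      using step.hyps(2) skeleton_cover_iff[of "inv X" "inv Y"] S(1)[OF S'(1)] S'(2) w by simp
    then show ?case using step.IH by (meson rtranclp.rtrancl_into_rtrancl)
  qed simp
  have iff: "(skeleton_cover n c w)\<^sup>*\<^sup>* u v \<longleftrightarrow> vertex_cover\<^sup>*\<^sup>* (inv u) (inv v)"
    if "u \<in> ?S" "v \<in> ?S" for u v
    using to_vertex[of u v] from_vertex[of "inv u" "inv v"] S(1)[OF that(1)] S(1)[OF that(2)]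
    by (auto simp: permutes_inv_inv)
  show ?thesis
    unfolding skeleton_poset_def
  proof (rule lattice_if_meets_exist)
    fix u v assume uv: "u \<in> ?S" "v \<in> ?S"
      and "(skeleton_cover n c w)\<^sup>*\<^sup>* u v" "(skeleton_cover n c w)\<^sup>*\<^sup>* v u"
    then have "inv u = inv v" using to_vertex vertex_covers_antisym by blast
    then show "u = v" using S(1)[OF uv(1)] S(1)[OF uv(2)] by (metis permutes_inv_inv)
  next
    fix Z assume Z: "Z \<subseteq> ?S"
    have "inv ` Z \<subseteq> A" using Z S(2) by blast
    then obtain m where m: "m \<in> A" "\<forall>V\<in>inv ` Z. vertex_cover\<^sup>*\<^sup>* m V"
      "\<forall>U\<in>A. (\<forall>V\<in>inv ` Z. vertex_cover\<^sup>*\<^sup>* U V) \<longrightarrow> vertex_cover\<^sup>*\<^sup>* U m"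
      using vertex_meet_exists by blast
    note m' = S'[OF m(1)]
    show "\<exists>m\<in>?S. (\<forall>z\<in>Z. (skeleton_cover n c w)\<^sup>*\<^sup>* m z) \<and>
      (\<forall>x\<in>?S. (\<forall>z\<in>Z. (skeleton_cover n c w)\<^sup>*\<^sup>* x z) \<longrightarrow> (skeleton_cover n c w)\<^sup>*\<^sup>* x m)"
    proof (intro bexI[of _ "inv m"] conjI ballI impI)
      fix z assume "z \<in> Z"
      then show "(skeleton_cover n c w)\<^sup>*\<^sup>* (inv m) z"
        using iff[OF m'(1), of z] m(2) m'(2) Z by auto
    next
      fix x assume x: "x \<in> ?S" and "\<forall>z\<in>Z. (skeleton_cover n c w)\<^sup>*\<^sup>* x z"
      then have "\<forall>V\<in>inv ` Z. vertex_cover\<^sup>*\<^sup>* (inv x) V" using to_vertex by blast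
      then have "vertex_cover\<^sup>*\<^sup>* (inv x) m" using m(3) S(2)[OF x] by blast
      then show "(skeleton_cover n c w)\<^sup>*\<^sup>* x (inv m)" using iff[OF x m'(1)] m'(2) by simp
    qed (rule m'(1))
  qed auto
qed

end
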